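(* Let $p,q\in[1,2]$, let $q^*$ satisfy $\frac1q+\frac1{q^*}=1$, let $\gamma>1$ be a constant, and let $1\le r\le n$. If $(\mathcal{S},f)$ is a $(k,\gamma)$-sketching family for the $q\to p$ norm of rank-$r$ real $n\times n$ matrices, then $k=\Omega(nr/d^2)$, where $d=\max\{\sqrt{r},n^{1/q^*}\}$.
   Context: $\|A\|_{q\to p}=\sup_{x\ne0}\frac{\|Ax\|_p}{\|x\|_q}$. A $(k,\alpha)$-sketching family for the $q\to p$ norm of a class of matrices is a pair $(\mathcal{S},f)$ where $\mathcal{S}$ is a distribution over linear maps $L$ from the matrix space to $\mathbb{R}^k$ and $f:\mathbb{R}^k\to\mathbb{R}$, such that for every $A$ in the class, $\Pr_{L\sim\mathcal{S}}\big[f(L(A))\in(\tfrac1\alpha\|A\|_{q\to p},\,\alpha\|A\|_{q\to p})\big]\ge \frac56$. *)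

theory Defs
  imports "HOL-Probability.Probability" "Jordan_Normal_Form.DL_Rank"
begin

definition lp_norm :: "real \<Rightarrow> real vec \<Rightarrow> real" where
  "lp_norm p x = (\<Sum>i<dim_vec x. \<bar>vec_index x i\<bar> powr p) powr (1 / p)"

(* The supremum is over a nonempty bounded set whenever A has at least one column
   and p, q >= 1, so the real-valued Sup is the true one. *)
definition op_norm :: "real \<Rightarrow> real \<Rightarrow> real mat \<Rightarrow> real" where
  "op_norm q p A =
    (SUP x \<in> carrier_vec (dim_col A) - {0\<^sub>v (dim_col A)}. lp_norm p (A *\<^sub>v x) / lp_norm q x)"

definition rank_matrices :: "nat \<Rightarrow> nat \<Rightarrow> real mat set" where
  "rank_matrices n r = {A \<in> carrier_mat n n. vec_space.rank n A = r}"

abbreviation euclid_borel :: "'i set \<Rightarrow> ('i \<Rightarrow> real) measure" where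
  "euclid_borel I \<equiv> PiM I (\<lambda>_. borel)"

(* A linear map from the n x n matrices to R^k is given by its coefficients c (l, i, j), where
   l < k indexes the output coordinate and (i, j) the matrix entry. A point of R^k is a
   function on {..<k} that is undefined outside, i.e. a point
   of the space of euclid_borel {..<k}. *)
definition linear_map :: "nat \<Rightarrow> nat \<Rightarrow> (nat \<times> nat \<times> nat \<Rightarrow> real) \<Rightarrow> real mat \<Rightarrow> (nat \<Rightarrow> real)" where
  "linear_map k n c A = (\<lambda>l\<in>{..<k}. \<Sum>i<n. \<Sum>j<n. c (l, i, j) * A $$ (i, j))"

definition coeff_indices :: "nat \<Rightarrow> nat \<Rightarrow> (nat \<times> nat \<times> nat) set" where
  "coeff_indices k n = {..<k} \<times> {..<n} \<times> {..<n}"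

(* S is an arbitrary Borel probability distribution on the space of linear maps, identified with
   R^(k n^2) through the coefficients. Borel measurability of f makes the probabilities below
   meaningful. *)
definition sketching_family ::
  "nat \<Rightarrow> real \<Rightarrow> real \<Rightarrow> real \<Rightarrow> nat \<Rightarrow> real mat set \<Rightarrow>
    (nat \<times> nat \<times> nat \<Rightarrow> real) measure \<Rightarrow> ((nat \<Rightarrow> real) \<Rightarrow> real) \<Rightarrow> bool" where
  "sketching_family k \<alpha> q p n \<A> S f \<longleftrightarrow>
     prob_space S \<and> sets S = sets (euclid_borel (coeff_indices k n)) \<and>
     f \<in> borel_measurable (euclid_borel {..<k}) \<and>
     (\<forall>A\<in>\<A>. measure S {c \<in> space S. f (linear_map k n c A) \<in>
                  {1 / \<alpha> * op_norm q p A <..< \<alpha> * op_norm q p A}} \<ge> 5 / 6)"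

end

theory Submission
  imports Defs "Jordan_Normal_Form.DL_Rank_Submatrix" "Jordan_Normal_Form.Char_Poly"
    "HOL-Real_Asymp.Real_Asymp"
begin

text \<open>
  Consider an \<open>r \<times> n\<close> Gaussian matrix \<open>X\<close>, padded with zero rows, and the
  same matrix with a planted column \<open>s u\<close>, where \<open>u\<close> is a sign vector and the column index
  \<open>j\<close> is uniform.  With \<open>1 / a\<close> close to \<open>1 / q\<^sup>*\<close> and
  \<open>a \<le> max 2 (ln n)\<close>, a Chernoff bound over a grid of the unit ball shows that
  \<open>\<parallel>X\<parallel>\<close> is at most \<open>r powr (1 / p - 1 / 2) * R\<close> with \<open>R\<close> of order
  \<open>\<surd>r + \<surd>a * n powr (1 / a)\<close>, so \<open>s\<close> of order \<open>R / \<surd>r\<close> separates the two norms by a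
  factor \<open>\<gamma>\<^sup>2\<close> and a successful sketch distinguishes the two laws.  By averaging, some
  fixed linear map \<open>L\<close> does.  But \<open>L\<close> sees a plant only through its orthogonal projection
  to a space of dimension \<open>k\<close>, whose energy is on average \<open>s\<^sup>2 k / n\<close>.  If this is
  below a small constant \<open>\<theta>\<close>, the shifted Gaussians are indistinguishable, hence \<open>k\<close> is at
  least of order \<open>n r / R\<^sup>2\<close>.

  The factor \<open>\<surd>a\<close> in \<open>R\<close> would cost more than a constant if \<open>a\<close> is large and
  \<open>r < a n powr (2 / a)\<close>.  In this regime the uncertainty about \<open>j\<close> helps: the chi-square
  distance of the mixture stays small even for \<open>\<theta> = ln n / 16\<close>, which compensates for
  \<open>a \<le> ln n\<close>.
\<close>

section \<open>Gaussian arrays and their translates\<close>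

text \<open>The net discretises the unit ball of the output space, of dimension \<open>r\<close>,
  and has up to \<open>exp (6 * real r)\<close> points, so every tail bound must be exponentially
  small in \<open>r\<close>. For \<open>a > 2\<close> the \<open>a\<close>-th powers of Gaussian
  coordinates have no exponential moments, so a direct Chernoff bound for the \<open>a\<close>-norm
  is impossible. Coordinates are therefore split by size: the few large ones are paid for in the
  Euclidean norm at a price of order \<open>sqrt r\<close>, which \<open>q \<le> 2\<close> permits,
  and the others are bounded.

  The random signs serve only to average. For one fixed \<open>u\<close> a projection of rank
  \<open>m\<close> may capture total energy as large as \<open>s\<^sup>2 * r * m\<close> over the
  columns, for instance when the measurements are the plants themselves; averaged over all signs the
  total is \<open>s\<^sup>2 * m\<close>. The chi-square comparison is made for each \<open>u\<close>
  separately, with \<open>j\<close> alone as the mixing variable.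

  The sketch is guaranteed to work only at rank exactly \<open>r\<close>, so singular arrays must be
  shown to be null, both with and without the plant.\<close>

definition gauss :: "real measure" where
  "gauss = density lborel (\<lambda>x. ennreal (std_normal_density x))"

lemma prob_space_gauss: "prob_space gauss"
  unfolding gauss_def by (rule prob_space_normal_density) simp

lemma sets_gauss [simp, measurable_cong]: "sets gauss = sets borel"
  by (simp add: gauss_def)

lemma space_gauss [simp]: "space gauss = UNIV"
  by (simp add: gauss_def)

text \<open>Both sides agree on rectangles with the product of the measures
  \<open>density (M i) (g i)\<close>. The general form serves twice, for the entries of a column and
  for the columns of an array.\<close>

lemma distr_PiM_density:
  fixes M :: "'i \<Rightarrow> 'a measure" and g :: "'i \<Rightarrow> 'a \<Rightarrow> ennreal"
  assumes "finite I" and ps: "\<And>i. prob_space (M i)"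
    and T [measurable]: "\<And>i. T i \<in> M i \<rightarrow>\<^sub>M M i"
    and g [measurable]: "\<And>i. g i \<in> borel_measurable (M i)"
    and dens: "\<And>i. distr (M i) (M i) (T i) = density (M i) (g i)"
  shows "distr (PiM I M) (PiM I M) (\<lambda>x. \<lambda>i\<in>I. T i (x i)) =
         density (PiM I M) (\<lambda>x. \<Prod>i\<in>I. g i (x i))"
proof -
  have ps': "prob_space (density (M i) (g i))" for i
    unfolding dens[symmetric] by (rule prob_space.prob_space_distr[OF ps]) simp
  interpret P: product_sigma_finite M
    by (simp add: product_sigma_finite_def ps prob_space_imp_sigma_finite)
  interpret D: product_sigma_finite "\<lambda>i. density (M i) (g i)"
    by (simp add: product_sigma_finite_def ps' prob_space_imp_sigma_finite)
  have sets_eq: "sets (PiM I (\<lambda>i. density (M i) (g i))) = sets (PiM I M)"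
    by (rule sets_PiM_cong) auto
  have "distr (PiM I M) (PiM I M) (\<lambda>x. \<lambda>i\<in>I. T i (x i)) = PiM I (\<lambda>i. density (M i) (g i))"
  proof (rule D.PiM_eqI[OF \<open>finite I\<close>])
    show "sets (distr (PiM I M) (PiM I M) (\<lambda>x. \<lambda>i\<in>I. T i (x i))) =
        sets (PiM I (\<lambda>i. density (M i) (g i)))"
      using sets_eq by simp
  next
    fix A assume "\<And>i. i \<in> I \<Longrightarrow> A i \<in> sets (density (M i) (g i))"
    then have A: "\<And>i. i \<in> I \<Longrightarrow> A i \<in> sets (M i)" by simp
    have meas: "(\<lambda>x. \<lambda>i\<in>I. T i (x i)) \<in> PiM I M \<rightarrow>\<^sub>M PiM I M"
      by measurable
    have "(\<lambda>x. \<lambda>i\<in>I. T i (x i)) -` Pi\<^sub>E I A \<inter> space (PiM I M) =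
        Pi\<^sub>E I (\<lambda>i. T i -` A i \<inter> space (M i))"
      by (auto simp: space_PiM PiE_def Pi_def extensional_def)
    moreover have "Pi\<^sub>E I A \<in> sets (PiM I M)"
      using A \<open>finite I\<close> by (intro sets_PiM_I_finite) auto
    ultimately have "emeasure (distr (PiM I M) (PiM I M) (\<lambda>x. \<lambda>i\<in>I. T i (x i))) (Pi\<^sub>E I A) =
        emeasure (PiM I M) (Pi\<^sub>E I (\<lambda>i. T i -` A i \<inter> space (M i)))"
      using meas by (simp add: emeasure_distr)
    also have "\<dots> = (\<Prod>i\<in>I. emeasure (M i) (T i -` A i \<inter> space (M i)))"
      using A by (intro P.emeasure_PiM[OF \<open>finite I\<close>] measurable_sets[OF T])
    also have "\<dots> = (\<Prod>i\<in>I. emeasure (distr (M i) (M i) (T i)) (A i))"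
      using A by (intro prod.cong) (auto simp: emeasure_distr)
    finally show "emeasure (distr (PiM I M) (PiM I M) (\<lambda>x. \<lambda>i\<in>I. T i (x i))) (Pi\<^sub>E I A) =
        (\<Prod>i\<in>I. emeasure (density (M i) (g i)) (A i))"
      by (simp add: dens)
  qed
  also have "\<dots> = density (PiM I M) (\<lambda>x. \<Prod>i\<in>I. g i (x i))"
  proof (rule D.PiM_eqI[OF \<open>finite I\<close>, symmetric])
    show "sets (density (PiM I M) (\<lambda>x. \<Prod>i\<in>I. g i (x i))) = sets (PiM I (\<lambda>i. density (M i) (g i)))"
      using sets_eq by simp
  next
    fix A assume "\<And>i. i \<in> I \<Longrightarrow> A i \<in> sets (density (M i) (g i))"
    then have A [measurable]: "\<And>i. i \<in> I \<Longrightarrow> A i \<in> sets (M i)" by simp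
    have *: "Pi\<^sub>E I A \<in> sets (PiM I M)"
      using A \<open>finite I\<close> by (intro sets_PiM_I_finite) auto
    have gm: "(\<lambda>x. \<Prod>i\<in>I. g i (x i)) \<in> borel_measurable (PiM I M)"
      by measurable
    have "emeasure (density (PiM I M) (\<lambda>x. \<Prod>i\<in>I. g i (x i))) (Pi\<^sub>E I A) =
        (\<integral>\<^sup>+x. (\<Prod>i\<in>I. g i (x i)) * indicator (Pi\<^sub>E I A) x \<partial>PiM I M)"
      using * gm by (simp add: emeasure_density)
    also have "\<dots> = (\<integral>\<^sup>+x. (\<Prod>i\<in>I. g i (x i) * indicator (A i) (x i)) \<partial>PiM I M)"
    proof (rule nn_integral_cong)
      fix x assume x: "x \<in> space (PiM I M)"
      have "indicator (Pi\<^sub>E I A) x = (\<Prod>i\<in>I. indicator (A i) (x i) :: ennreal)"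
      proof (cases "x \<in> Pi\<^sub>E I A")
        case True
        then show ?thesis by (auto simp: PiE_def Pi_def)
      next
        case False
        then obtain i where "i \<in> I" "x i \<notin> A i" using x by (auto simp: PiE_def space_PiM)
        then show ?thesis using False \<open>finite I\<close> by (auto simp: indicator_def intro!: prod_zero[symmetric])
      qed
      then show "(\<Prod>i\<in>I. g i (x i)) * indicator (Pi\<^sub>E I A) x = (\<Prod>i\<in>I. g i (x i) * indicator (A i) (x i))"
        by (simp add: prod.distrib)
    qed
    also have "\<dots> = (\<Prod>i\<in>I. \<integral>\<^sup>+x. g i x * indicator (A i) x \<partial>M i)"
      by (rule P.product_nn_integral_prod[OF \<open>finite I\<close>]) measurable
    also have "\<dots> = (\<Prod>i\<in>I. emeasure (density (M i) (g i)) (A i))"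
      using A g by (intro prod.cong) (auto simp: emeasure_density)
    finally show "emeasure (density (PiM I M) (\<lambda>x. \<Prod>i\<in>I. g i (x i))) (Pi\<^sub>E I A) =
        (\<Prod>i\<in>I. emeasure (density (M i) (g i)) (A i))" .
  qed
  finally show ?thesis .
qed

text \<open>Cameron-Martin formula on the line: Lebesgue measure is translation invariant, and the
  exponential is the quotient of the two normal densities.\<close>

lemma distr_gauss_shift:
  "distr gauss gauss (\<lambda>x. x + h) = density gauss (\<lambda>x. ennreal (exp (h * x - h\<^sup>2 / 2)))"
proof -
  have "distr gauss gauss (\<lambda>x. x + h) = distr (density lborel (\<lambda>x. ennreal (std_normal_density x))) borel (\<lambda>x. x + h)"
    by (simp add: gauss_def cong: distr_cong)
  also have "\<dots> = density (distr lborel borel (\<lambda>x. x + h)) (\<lambda>x. ennreal (std_normal_density (x - h)))"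
    by (subst density_distr) (auto simp: intro!: distr_cong)
  also have "distr lborel borel (\<lambda>x. x + h) = (lborel :: real measure)"
    using lborel_distr_plus[of h] by (simp add: add.commute[of _ h])
  also have "density lborel (\<lambda>x. ennreal (std_normal_density (x - h))) =
     density gauss (\<lambda>x. ennreal (exp (h * x - h\<^sup>2 / 2)))"
  proof -
    have *: "std_normal_density (x - h) = std_normal_density x * exp (h * x - h\<^sup>2 / 2)" for x
      unfolding std_normal_density_def mult.assoc exp_add[symmetric]
      by (simp add: power2_eq_square field_simps)
    show ?thesis unfolding gauss_def * 
      by (subst density_density_eq) (auto simp: ennreal_mult)
  qed
  finally show ?thesis .
qed

definition gvec :: "nat \<Rightarrow> (nat \<Rightarrow> real) measure" where
  "gvec r = PiM {..<r} (\<lambda>_. gauss)"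

text \<open>A point \<open>X\<close> of \<open>gmat n r\<close> is a family of columns: \<open>X j i\<close> is the entry in row
  \<open>i < r\<close> and column \<open>j < n\<close>.\<close>

definition gmat :: "nat \<Rightarrow> nat \<Rightarrow> (nat \<Rightarrow> nat \<Rightarrow> real) measure" where
  "gmat n r = PiM {..<n} (\<lambda>_. gvec r)"

lemma prob_space_gvec: "prob_space (gvec r)"
  unfolding gvec_def by (rule prob_space_PiM) (rule prob_space_gauss)

lemma prob_space_gmat: "prob_space (gmat n r)"
  unfolding gmat_def by (rule prob_space_PiM) (rule prob_space_gvec)

lemma measurable_gvec [measurable]: "i < r \<Longrightarrow> (\<lambda>x. x i) \<in> borel_measurable (gvec r)"
  unfolding gvec_def
  by (subst measurable_cong_sets[OF refl sets_gauss[symmetric]]) (rule measurable_component_singleton, simp)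

lemma measurable_gmat_col [measurable]: "j < n \<Longrightarrow> (\<lambda>X. X j) \<in> gmat n r \<rightarrow>\<^sub>M gvec r"
  unfolding gmat_def by (rule measurable_component_singleton) simp

lemma measurable_gmat [measurable]: "j < n \<Longrightarrow> i < r \<Longrightarrow> (\<lambda>X. X j i) \<in> borel_measurable (gmat n r)"
  by (rule measurable_compose[OF measurable_gmat_col measurable_gvec])

text \<open>Frobenius inner product. Arrays are total functions whose values outside the index range
  are ignored.\<close>

definition dot :: "nat \<Rightarrow> nat \<Rightarrow> (nat \<Rightarrow> nat \<Rightarrow> real) \<Rightarrow> (nat \<Rightarrow> nat \<Rightarrow> real) \<Rightarrow> real" where
  "dot n r g h = (\<Sum>j<n. \<Sum>i<r. g j i * h j i)"

text \<open>The restriction keeps the translate in the space of \<open>gmat n r\<close> even if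
  \<open>h\<close>, such as a plant or a projection, is not extensional.\<close>

definition array_shift :: "nat \<Rightarrow> nat \<Rightarrow> (nat \<Rightarrow> nat \<Rightarrow> real) \<Rightarrow> (nat \<Rightarrow> nat \<Rightarrow> real) \<Rightarrow> (nat \<Rightarrow> nat \<Rightarrow> real)" where
  "array_shift n r h X = (\<lambda>j\<in>{..<n}. \<lambda>i\<in>{..<r}. X j i + h j i)"

text \<open>Cameron-Martin density of the law translated by \<open>h\<close> with respect to
  \<open>gmat n r\<close>.\<close>

definition shift_density :: "nat \<Rightarrow> nat \<Rightarrow> (nat \<Rightarrow> nat \<Rightarrow> real) \<Rightarrow> (nat \<Rightarrow> nat \<Rightarrow> real) \<Rightarrow> real" where
  "shift_density n r h X = exp (dot n r h X - dot n r h h / 2)"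

lemma measurable_shift_vec: "(\<lambda>x. \<lambda>i\<in>{..<r}. x i + h i) \<in> gvec r \<rightarrow>\<^sub>M gvec r"
proof -
  have "(\<lambda>x. \<lambda>i\<in>{..<r}. x i + h i) \<in> gvec r \<rightarrow>\<^sub>M PiM {..<r} (\<lambda>_. gauss)"
    by (rule measurable_restrict) simp
  then show ?thesis by (simp add: gvec_def)
qed

lemma measurable_shift [measurable]: "array_shift n r h \<in> gmat n r \<rightarrow>\<^sub>M gmat n r"
proof -
  have "(\<lambda>X. array_shift n r h X) \<in> gmat n r \<rightarrow>\<^sub>M PiM {..<n} (\<lambda>_. gvec r)"
    unfolding array_shift_def
    by (rule measurable_restrict) (rule measurable_compose[OF measurable_gmat_col measurable_shift_vec], simp)
  then show ?thesis by (simp add: gmat_def)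
qed

lemma measurable_dot [measurable]: "dot n r h \<in> borel_measurable (gmat n r)"
  unfolding dot_def by measurable

lemma measurable_shift_density [measurable]: "shift_density n r h \<in> borel_measurable (gmat n r)"
  unfolding shift_density_def by measurable

lemma distr_gvec_shift:
  "distr (gvec r) (gvec r) (\<lambda>x. \<lambda>i\<in>{..<r}. x i + h i) =
   density (gvec r) (\<lambda>x. ennreal (exp (\<Sum>i<r. h i * x i - (h i)\<^sup>2 / 2)))"
proof -
  have "distr (gvec r) (gvec r) (\<lambda>x. \<lambda>i\<in>{..<r}. x i + h i) =
      density (gvec r) (\<lambda>x. \<Prod>i\<in>{..<r}. ennreal (exp (h i * x i - (h i)\<^sup>2 / 2)))"
    unfolding gvec_def
    by (rule distr_PiM_density)
       (simp_all add: prob_space_gauss distr_gauss_shift cong: measurable_cong_sets)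
  then show ?thesis
    by (simp add: prod_ennreal exp_sum)
qed

lemma distr_gmat_shift:
  "distr (gmat n r) (gmat n r) (array_shift n r h) = density (gmat n r) (\<lambda>X. ennreal (shift_density n r h X))"
proof -
  have "distr (gmat n r) (gmat n r) (array_shift n r h) =
      density (gmat n r) (\<lambda>X. \<Prod>j\<in>{..<n}. ennreal (exp (\<Sum>i<r. h j i * X j i - (h j i)\<^sup>2 / 2)))"
    unfolding gmat_def array_shift_def
    by (rule distr_PiM_density[OF _ prob_space_gvec measurable_shift_vec _ distr_gvec_shift]) simp_all
  also have "(\<lambda>X. \<Prod>j\<in>{..<n}. ennreal (exp (\<Sum>i<r. h j i * X j i - (h j i)\<^sup>2 / 2))) =
      (\<lambda>X. ennreal (shift_density n r h X))"
    by (simp add: prod_ennreal exp_sum[symmetric] shift_density_def dot_def sum_subtractf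
        sum_divide_distrib power2_eq_square)
  finally show ?thesis .
qed

lemma nn_integral_gmat_shift:
  assumes [measurable]: "F \<in> borel_measurable (gmat n r)"
  shows "(\<integral>\<^sup>+X. F (array_shift n r h X) \<partial>gmat n r) = (\<integral>\<^sup>+X. ennreal (shift_density n r h X) * F X \<partial>gmat n r)"
  by (subst nn_integral_distr[symmetric, of "array_shift n r h" "gmat n r" "gmat n r"])
     (simp_all add: distr_gmat_shift nn_integral_density)

lemma nn_integral_normal_density: "\<sigma> > 0 \<Longrightarrow> (\<integral>\<^sup>+x. ennreal (normal_density \<mu> \<sigma> x) \<partial>lborel) = 1"
  using prob_space.emeasure_space_1[OF prob_space_normal_density, of \<sigma> \<mu>]
  by (simp add: emeasure_density cong: nn_integral_cong)

lemma nn_integral_gauss: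
  "f \<in> borel_measurable borel \<Longrightarrow>
    (\<integral>\<^sup>+x. f x \<partial>gauss) = (\<integral>\<^sup>+x. ennreal (std_normal_density x) * f x \<partial>lborel)"
  unfolding gauss_def by (rule nn_integral_density) auto

lemma nn_integral_gauss_exp: "(\<integral>\<^sup>+t. ennreal (exp (h * t)) \<partial>gauss) = ennreal (exp (h\<^sup>2 / 2))"
proof -
  have *: "std_normal_density t * exp (h * t) = exp (h\<^sup>2 / 2) * normal_density h 1 t" for t
  proof -
    have "exp (- t\<^sup>2 / 2) * exp (h * t) = exp (h\<^sup>2 / 2) * exp (- (t - h)\<^sup>2 / 2)"
      unfolding exp_add[symmetric] by (simp add: power2_eq_square field_simps)
    then show ?thesis by (simp add: std_normal_density_def normal_density_def)
  qed
  have "(\<integral>\<^sup>+t. ennreal (exp (h * t)) \<partial>gauss) =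
      (\<integral>\<^sup>+t. ennreal (exp (h\<^sup>2 / 2)) * ennreal (normal_density h 1 t) \<partial>lborel)"
    by (subst nn_integral_gauss) (auto simp: ennreal_mult[symmetric] *)
  then show ?thesis by (simp add: nn_integral_cmult nn_integral_normal_density)
qed

lemma nn_integral_gvec_exp:
  "(\<integral>\<^sup>+x. ennreal (exp (\<Sum>i<r. h i * x i)) \<partial>gvec r) = ennreal (exp ((\<Sum>i<r. (h i)\<^sup>2) / 2))"
proof -
  interpret product_sigma_finite "\<lambda>_. gauss"
    by (simp add: product_sigma_finite_def prob_space_gauss prob_space_imp_sigma_finite)
  have "(\<integral>\<^sup>+x. ennreal (exp (\<Sum>i<r. h i * x i)) \<partial>gvec r) =
      (\<integral>\<^sup>+x. (\<Prod>i\<in>{..<r}. ennreal (exp (h i * x i))) \<partial>gvec r)"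
    by (simp add: exp_sum prod_ennreal)
  also have "\<dots> = (\<Prod>i\<in>{..<r}. \<integral>\<^sup>+t. ennreal (exp (h i * t)) \<partial>gauss)"
    unfolding gvec_def
    by (rule product_nn_integral_prod) (simp_all cong: measurable_cong_sets)
  also have "\<dots> = ennreal (exp ((\<Sum>i<r. (h i)\<^sup>2) / 2))"
    by (simp add: nn_integral_gauss_exp prod_ennreal exp_sum sum_divide_distrib)
  finally show ?thesis .
qed

lemma has_bochner_integral_shift_density:
  "has_bochner_integral (gmat n r) (shift_density n r h) 1"
proof (rule has_bochner_integral_nn_integral)
  have "(\<integral>\<^sup>+X. ennreal (shift_density n r h X) \<partial>gmat n r) = (\<integral>\<^sup>+X. 1 \<partial>gmat n r)"
    using nn_integral_gmat_shift[of "\<lambda>_. 1" n r h] by simp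
  then show "(\<integral>\<^sup>+X. ennreal (shift_density n r h X) \<partial>gmat n r) = ennreal 1"
    by (simp add: prob_space.emeasure_space_1[OF prob_space_gmat])
qed (auto simp: shift_density_def)

text \<open>Up to the factor \<open>exp (dot n r g h)\<close> the product is the density for the sum
  of the two shifts. Hence the chi-square distance of a mixture depends only on the Gram matrix of
  its shifts.\<close>

lemma has_bochner_integral_shift_density_mult:
  "has_bochner_integral (gmat n r) (\<lambda>X. shift_density n r g X * shift_density n r h X) (exp (dot n r g h))"
proof -
  have "shift_density n r g X * shift_density n r h X =
      exp (dot n r g h) * shift_density n r (\<lambda>j i. g j i + h j i) X" for X
    unfolding shift_density_def exp_add[symmetric] dot_def
    by (simp add: algebra_simps sum.distrib add_divide_distrib sum_divide_distrib)
  then show ?thesis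
    using has_bochner_integral_mult_right[OF has_bochner_integral_shift_density[of n r "\<lambda>j i. g j i + h j i"], of "exp (dot n r g h)"]
    by simp
qed

section \<open>Projections and the second-moment method\<close>

lemma dot_commute: "dot n r g h = dot n r h g"
  by (simp add: dot_def mult.commute)

lemma dot_self_nonneg: "0 \<le> dot n r h h"
  unfolding dot_def by (intro sum_nonneg) simp

lemma dot_self_eq_0_iff: "dot n r h h = 0 \<longleftrightarrow> (\<forall>j<n. \<forall>i<r. h j i = 0)"
  by (auto simp: dot_def sum_nonneg_eq_0_iff sum_nonneg)

lemma dot_add_right: "dot n r g (\<lambda>j i. h j i + h' j i) = dot n r g h + dot n r g h'"
  by (simp add: dot_def algebra_simps sum.distrib)

lemma dot_diff_left: "dot n r (\<lambda>j i. h j i - h' j i) g = dot n r h g - dot n r h' g"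
  by (simp add: dot_def algebra_simps sum_subtractf)

lemma dot_scale_left: "dot n r (\<lambda>j i. c * h j i) g = c * dot n r h g"
  by (simp add: dot_def sum_distrib_left mult.assoc)

lemma dot_sum_left: "dot n r (\<lambda>j i. \<Sum>a\<in>A. h a j i) g = (\<Sum>a\<in>A. dot n r (h a) g)"
proof -
  have "dot n r (\<lambda>j i. \<Sum>a\<in>A. h a j i) g = (\<Sum>j<n. \<Sum>i<r. \<Sum>a\<in>A. h a j i * g j i)"
    by (simp add: dot_def sum_distrib_right)
  also have "\<dots> = (\<Sum>j<n. \<Sum>a\<in>A. \<Sum>i<r. h a j i * g j i)"
    by (intro sum.cong refl sum.swap)
  also have "\<dots> = (\<Sum>a\<in>A. dot n r (h a) g)"
    unfolding dot_def by (rule sum.swap)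
  finally show ?thesis .
qed

text \<open>AM-GM entry by entry. This weak form of Cauchy-Schwarz suffices for pairs whose energies
  share a common bound.\<close>

lemma dot_le_half: "\<bar>dot n r g h\<bar> \<le> (dot n r g g + dot n r h h) / 2"
proof -
  have *: "\<bar>x * y\<bar> \<le> (x * x + y * y) / 2" for x y :: real
    using sum_squares_bound[of "\<bar>x\<bar>" "\<bar>y\<bar>"] by (simp add: abs_mult power2_eq_square)
  have "\<bar>dot n r g h\<bar> \<le> (\<Sum>j<n. \<Sum>i<r. \<bar>g j i * h j i\<bar>)"
    unfolding dot_def by (rule order_trans[OF sum_abs sum_mono[OF sum_abs]])
  also have "\<dots> \<le> (\<Sum>j<n. \<Sum>i<r. (g j i * g j i + h j i * h j i) / 2)"
    by (intro sum_mono *)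
  also have "\<dots> = (dot n r g g + dot n r h h) / 2"
    by (simp add: dot_def sum.distrib sum_divide_distrib add_divide_distrib)
  finally show ?thesis .
qed

text \<open>Gram-Schmidt. That the \<open>v l\<close> lie in the span of the \<open>B a\<close> is
  expressed dually, through orthogonality, which is the form used later; \<open>m\<close> drops
  below \<open>k\<close> if the \<open>v l\<close> are dependent.\<close>

lemma ex_orthonormal_family:
  fixes v :: "nat \<Rightarrow> nat \<Rightarrow> nat \<Rightarrow> real"
  shows "\<exists>m\<le>k. \<exists>B. (\<forall>a<m. \<forall>b<m. dot n r (B a) (B b) = (if a = b then 1 else 0)) \<and>
     (\<forall>l<k. \<forall>h. (\<forall>a<m. dot n r (B a) h = 0) \<longrightarrow> dot n r (v l) h = 0)"
proof (induction k)
  case 0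
  then show ?case by auto
next
  case (Suc k)
  then obtain m B where m: "m \<le> k"
    and B: "\<And>a b. a < m \<Longrightarrow> b < m \<Longrightarrow> dot n r (B a) (B b) = (if a = b then 1 else 0)"
    and v: "\<And>l h. l < k \<Longrightarrow> (\<forall>a<m. dot n r (B a) h = 0) \<Longrightarrow> dot n r (v l) h = 0"
    by blast
  \<comment> \<open>The residual of the new vector after removing its components along the earlier
    \<open>B a\<close>.\<close>
  define w where "w = (\<lambda>j i. v k j i - (\<Sum>a<m. dot n r (v k) (B a) * B a j i))"
  have dot_w: "dot n r w h = dot n r (v k) h - (\<Sum>a<m. dot n r (v k) (B a) * dot n r (B a) h)" for h
    by (simp add: w_def dot_diff_left dot_sum_left dot_scale_left)
  have w_B: "dot n r w (B b) = 0" if "b < m" for b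
  proof -
    have "(\<Sum>a<m. dot n r (v k) (B a) * dot n r (B a) (B b)) =
        (\<Sum>a<m. if a = b then dot n r (v k) (B a) else 0)"
      using that by (intro sum.cong) (auto simp: B)
    then show ?thesis using that by (simp add: dot_w)
  qed
  show ?case
  proof (cases "dot n r w w = 0")
    case True
    then have "dot n r w h = 0" for h
      by (simp add: dot_self_eq_0_iff) (simp add: dot_def)
    then have "dot n r (v l) h = 0" if "l < Suc k" "\<forall>a<m. dot n r (B a) h = 0" for l h
      using that v[of l h] dot_w[of h] by (cases "l = k") auto
    then show ?thesis using m B by (intro exI[of _ m] conjI exI[of _ B]) auto
  next
    case False
    define c where "c = 1 / sqrt (dot n r w w)"
    define B' where "B' = B(m := \<lambda>j i. c * w j i)"
    have w_pos: "dot n r w w > 0" using False dot_self_nonneg[of n r w] by simp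
    have c: "c > 0" "c * (c * dot n r w w) = 1"
      using w_pos real_sqrt_pow2[of "dot n r w w"]
      by (auto simp: c_def field_simps power2_eq_square)
    have dot_scale_right: "dot n r g (\<lambda>j i. c * h j i) = c * dot n r g h" for g h
      by (metis dot_commute dot_scale_left)
    have "dot n r (B' a) (B' b) = (if a = b then 1 else 0)" if "a < Suc m" "b < Suc m" for a b
    proof -
      have "dot n r (B b) w = 0" if "b < m" for b
        using w_B[OF that] by (simp add: dot_commute)
      then show ?thesis
        using that B w_B c unfolding less_Suc_eq
        by (elim disjE) (simp_all add: B'_def dot_scale_left dot_scale_right)
    qed
    moreover have "dot n r (v l) h = 0" if "l < Suc k" and h: "\<forall>a<Suc m. dot n r (B' a) h = 0" for l h
    proof -
      have hB: "\<forall>a<m. dot n r (B a) h = 0"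
      proof safe
        fix a assume "a < m"
        then show "dot n r (B a) h = 0" using h[rule_format, of a] by (simp add: B'_def)
      qed
      have "dot n r w h = 0"
        using h[rule_format, of m] c by (simp add: B'_def dot_scale_left)
      then show ?thesis using that(1) hB v[of l h] dot_w[of h] by (cases "l = k") auto
    qed
    ultimately show ?thesis using m by (intro exI[of _ "Suc m"] conjI exI[of _ B']) auto
  qed
qed

lemma integral_gmat_shift:
  fixes F :: "(nat \<Rightarrow> nat \<Rightarrow> real) \<Rightarrow> real"
  assumes F [measurable]: "F \<in> borel_measurable (gmat n r)"
  shows "(\<integral>X. F (array_shift n r h X) \<partial>gmat n r) = (\<integral>X. shift_density n r h X * F X \<partial>gmat n r)"
proof -
  have "(\<integral>X. F (array_shift n r h X) \<partial>gmat n r) = integral\<^sup>L (distr (gmat n r) (gmat n r) (array_shift n r h)) F"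
    by (rule integral_distr[symmetric]) measurable
  also have "\<dots> = (\<integral>X. shift_density n r h X * F X \<partial>gmat n r)"
    unfolding distr_gmat_shift by (subst integral_density) (auto simp: shift_density_def)
  finally show ?thesis .
qed

text \<open>The second-moment (chi-square) method for a mixture of shifted Gaussians: the square
  root is linearised by \<open>w \<le> N / 8 + 2 w\<^sup>2 / N\<close>.\<close>

lemma sum_shift_advantage_le:
  fixes F :: "(nat \<Rightarrow> nat \<Rightarrow> real) \<Rightarrow> real" and N :: real
  assumes F [measurable]: "F \<in> borel_measurable (gmat n r)" and F01: "\<And>X. 0 \<le> F X" "\<And>X. F X \<le> 1"
    and "finite J" and N: "N > 0"
  shows "(\<Sum>a\<in>J. (\<integral>X. F X \<partial>gmat n r) - (\<integral>X. F (array_shift n r (\<mu> a) X) \<partial>gmat n r)) \<le>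
    N / 8 + 2 / N * (\<Sum>a\<in>J. \<Sum>b\<in>J. exp (dot n r (\<mu> a) (\<mu> b)) - 1)"
proof -
  let ?M = "gmat n r"
  let ?\<rho> = "\<lambda>a. shift_density n r (\<mu> a)"
  interpret prob_space ?M by (rule prob_space_gmat)
  define W where "W = (\<lambda>X. \<Sum>a\<in>J. 1 - ?\<rho> a X)"
  have int_\<rho>: "integrable ?M (?\<rho> a)" and I_\<rho>: "integral\<^sup>L ?M (?\<rho> a) = 1" for a
    using has_bochner_integral_shift_density[of n r "\<mu> a"] by (auto simp: has_bochner_integral_iff)
  have int_\<rho>\<rho>: "integrable ?M (\<lambda>X. ?\<rho> a X * ?\<rho> b X)"
    and I_\<rho>\<rho>: "(\<integral>X. ?\<rho> a X * ?\<rho> b X \<partial>?M) = exp (dot n r (\<mu> a) (\<mu> b))" for a b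
    using has_bochner_integral_shift_density_mult[of n r "\<mu> a" "\<mu> b"] by (auto simp: has_bochner_integral_iff)
  have int_F: "integrable ?M F"
    by (rule integrable_const_bound[of _ 1]) (use F01 in auto)
  have int_\<rho>F: "integrable ?M (\<lambda>X. ?\<rho> a X * F X)" for a
    by (rule Bochner_Integration.integrable_bound[OF int_\<rho>[of a]])
       (use F01 in \<open>auto simp: abs_mult shift_density_def mult_left_le\<close>)
  have W2: "(W X)\<^sup>2 = (\<Sum>a\<in>J. \<Sum>b\<in>J. 1 - ?\<rho> a X - ?\<rho> b X + ?\<rho> a X * ?\<rho> b X)" for X
    unfolding W_def power2_eq_square sum_product by (intro sum.cong refl) (simp add: algebra_simps)
  have int_W2: "integrable ?M (\<lambda>X. (W X)\<^sup>2)"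
    unfolding W2 by (intro Bochner_Integration.integrable_sum Bochner_Integration.integrable_add
        Bochner_Integration.integrable_diff int_\<rho> int_\<rho>\<rho>) auto
  have I_W2: "(\<integral>X. (W X)\<^sup>2 \<partial>?M) = (\<Sum>a\<in>J. \<Sum>b\<in>J. exp (dot n r (\<mu> a) (\<mu> b)) - 1)"
  proof -
    have "(\<integral>X. (W X)\<^sup>2 \<partial>?M) = (\<Sum>a\<in>J. \<Sum>b\<in>J. \<integral>X. 1 - ?\<rho> a X - ?\<rho> b X + ?\<rho> a X * ?\<rho> b X \<partial>?M)"
      unfolding W2 by (simp only: Bochner_Integration.integral_sum Bochner_Integration.integrable_sum
          Bochner_Integration.integrable_add Bochner_Integration.integrable_diff int_\<rho> int_\<rho>\<rho> integrable_const)
    also have "\<dots> = (\<Sum>a\<in>J. \<Sum>b\<in>J. exp (dot n r (\<mu> a) (\<mu> b)) - 1)"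
      by (intro sum.cong refl) (simp add: int_\<rho> int_\<rho>\<rho> I_\<rho> I_\<rho>\<rho> prob_space)
    finally show ?thesis .
  qed
  have "(\<Sum>a\<in>J. (\<integral>X. F X \<partial>?M) - (\<integral>X. F (array_shift n r (\<mu> a) X) \<partial>?M)) =
      (\<Sum>a\<in>J. \<integral>X. F X - ?\<rho> a X * F X \<partial>?M)"
    by (simp add: integral_gmat_shift int_F int_\<rho>F)
  also have "\<dots> = (\<integral>X. (\<Sum>a\<in>J. F X - ?\<rho> a X * F X) \<partial>?M)"
    by (rule Bochner_Integration.integral_sum[symmetric]) (simp add: int_F int_\<rho>F)
  also have "\<dots> \<le> (\<integral>X. N / 8 + 2 / N * (W X)\<^sup>2 \<partial>?M)"
  proof (rule integral_mono)
    show "integrable ?M (\<lambda>X. \<Sum>a\<in>J. F X - ?\<rho> a X * F X)"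
      by (simp add: int_F int_\<rho>F)
    show "integrable ?M (\<lambda>X. N / 8 + 2 / N * (W X)\<^sup>2)"
      by (intro Bochner_Integration.integrable_add integrable_mult_right int_W2) simp
  next
    fix X
    have "(\<Sum>a\<in>J. F X - ?\<rho> a X * F X) = F X * W X"
      unfolding W_def sum_distrib_left by (intro sum.cong refl) (simp add: algebra_simps)
    also have "\<dots> \<le> \<bar>W X\<bar>"
    proof -
      have "F X * W X \<le> F X * \<bar>W X\<bar>" using F01[of X] by (intro mult_left_mono) auto
      also have "\<dots> \<le> \<bar>W X\<bar>" using F01[of X] by (intro mult_left_le_one_le) auto
      finally show ?thesis .
    qed
    also have "\<dots> \<le> N / 8 + 2 / N * (W X)\<^sup>2"
    proof -
      have "0 \<le> (N / 4 - \<bar>W X\<bar>)\<^sup>2" by simp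
      also have "\<dots> = N\<^sup>2 / 16 - N / 2 * \<bar>W X\<bar> + (W X)\<^sup>2"
        by (simp add: power2_diff power_divide)
      finally have "N * \<bar>W X\<bar> \<le> N\<^sup>2 / 8 + 2 * (W X)\<^sup>2" by simp
      also have "\<dots> = N * (N / 8 + 2 / N * (W X)\<^sup>2)"
        using N by (simp add: power2_eq_square field_simps)
      finally have "N * \<bar>W X\<bar> \<le> N * (N / 8 + 2 / N * (W X)\<^sup>2)" .
      then show ?thesis using N by simp
    qed
    finally show "(\<Sum>a\<in>J. F X - ?\<rho> a X * F X) \<le> N / 8 + 2 / N * (W X)\<^sup>2" .
  qed
  also have "\<dots> = N / 8 + 2 / N * (\<Sum>a\<in>J. \<Sum>b\<in>J. exp (dot n r (\<mu> a) (\<mu> b)) - 1)"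
    by (simp add: int_W2 I_W2 prob_space)
  finally show ?thesis .
qed

section \<open>Sign vectors, plants and their projected energy\<close>

definition signs :: "nat \<Rightarrow> (nat \<Rightarrow> real) set" where
  "signs r = PiE {..<r} (\<lambda>_. {-1, 1})"

lemma finite_signs [simp]: "finite (signs r)"
  by (simp add: signs_def finite_PiE)

lemma card_signs [simp]: "card (signs r) = 2 ^ r"
  by (simp add: signs_def card_PiE numeral_2_eq_2)

lemma signs_square: "u \<in> signs r \<Longrightarrow> i < r \<Longrightarrow> (u i)\<^sup>2 = 1"
  unfolding signs_def by (drule PiE_mem[of _ _ _ i]) auto

text \<open>Independent signs are uncorrelated. The offset \<open>c\<close> carries the induction:
  splitting off one sign turns it into \<open>c - b x\<close> and \<open>c + b x\<close>, whose
  cross terms cancel.\<close>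

lemma sum_signs_square_aux:
  fixes b :: "'i \<Rightarrow> real"
  assumes "finite I"
  shows "(\<Sum>u\<in>PiE I (\<lambda>_. {-1, 1}). (c + (\<Sum>i\<in>I. u i * b i))\<^sup>2) = 2 ^ card I * (c\<^sup>2 + (\<Sum>i\<in>I. (b i)\<^sup>2))"
  using assms
proof (induction I arbitrary: c)
  case empty
  then show ?case by simp
next
  case (insert x I)
  let ?P = "PiE I (\<lambda>_. {-1, 1 :: real})"
  have upd: "(\<Sum>i\<in>insert x I. (u(x := y)) i * b i) = y * b x + (\<Sum>i\<in>I. u i * b i)"
    for u :: "'i \<Rightarrow> real" and y
    using insert.hyps by (simp, intro sum.cong) auto
  have "(\<Sum>u\<in>PiE (insert x I) (\<lambda>_. {-1, 1}). (c + (\<Sum>i\<in>insert x I. u i * b i))\<^sup>2) =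
      (\<Sum>(y, u)\<in>{-1, 1} \<times> ?P. ((c + y * b x) + (\<Sum>i\<in>I. u i * b i))\<^sup>2)"
    unfolding PiE_insert_eq
    by (subst sum.reindex[OF inj_combinator[OF insert.hyps(2)]])
       (simp only: comp_def case_prod_unfold upd add.assoc)
  also have "\<dots> = (\<Sum>y\<in>{-1, 1}. \<Sum>u\<in>?P. ((c + y * b x) + (\<Sum>i\<in>I. u i * b i))\<^sup>2)"
    by (rule sum.cartesian_product[symmetric])
  also have "\<dots> = (\<Sum>y\<in>{-1, 1}. 2 ^ card I * ((c + y * b x)\<^sup>2 + (\<Sum>i\<in>I. (b i)\<^sup>2)))"
    by (simp add: insert.IH)
  also have "\<dots> = 2 ^ card (insert x I) * (c\<^sup>2 + (\<Sum>i\<in>insert x I. (b i)\<^sup>2))"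
    using insert.hyps by (simp add: power2_eq_square algebra_simps)
  finally show ?case .
qed

lemma sum_signs_square:
  "(\<Sum>u\<in>signs r. (\<Sum>i<r. u i * b i)\<^sup>2) = 2 ^ r * (\<Sum>i<r. (b i)\<^sup>2)"
  using sum_signs_square_aux[of "{..<r}" 0 b] by (simp add: signs_def)

definition plant :: "real \<Rightarrow> (nat \<Rightarrow> real) \<Rightarrow> nat \<Rightarrow> nat \<Rightarrow> nat \<Rightarrow> real" where
  "plant s u j = (\<lambda>j' i. if j' = j then s * u i else 0)"

lemma dot_plant: "j < n \<Longrightarrow> dot n r w (plant s u j) = s * (\<Sum>i<r. u i * w j i)"
proof -
  assume "j < n"
  have "dot n r w (plant s u j) = (\<Sum>j'<n. if j' = j then s * (\<Sum>i<r. u i * w j i) else 0)"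
    unfolding dot_def plant_def by (intro sum.cong) (auto simp: sum_distrib_left intro!: sum.cong)
  then show ?thesis using \<open>j < n\<close> by simp
qed

text \<open>Bessel's inequality up to scaling: for fixed \<open>u\<close> the plants in different
  columns are orthogonal, each of squared norm \<open>s\<^sup>2 * real r\<close>. The proof is
  Cauchy-Schwarz in every column.\<close>

lemma sum_dot_plant_square_le:
  assumes u: "u \<in> signs r"
  shows "(\<Sum>j<n. (dot n r w (plant s u j))\<^sup>2) \<le> s\<^sup>2 * real r * dot n r w w"
proof -
  have "(\<Sum>j<n. (dot n r w (plant s u j))\<^sup>2) = (\<Sum>j<n. s\<^sup>2 * (\<Sum>i<r. u i * w j i)\<^sup>2)"
    by (simp add: dot_plant power_mult_distrib)
  also have "\<dots> \<le> (\<Sum>j<n. s\<^sup>2 * (real r * (\<Sum>i<r. (w j i)\<^sup>2)))"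
  proof (intro sum_mono mult_left_mono)
    fix j
    have "(\<Sum>i<r. u i * w j i)\<^sup>2 \<le> (\<Sum>i<r. (u i)\<^sup>2) * (\<Sum>i<r. (w j i)\<^sup>2)"
      by (rule Cauchy_Schwarz_ineq_sum)
    then show "(\<Sum>i<r. u i * w j i)\<^sup>2 \<le> real r * (\<Sum>i<r. (w j i)\<^sup>2)"
      by (simp add: signs_square[OF u])
  qed simp
  also have "\<dots> = s\<^sup>2 * real r * dot n r w w"
    by (simp add: dot_def sum_distrib_left power2_eq_square mult.assoc)
  finally show ?thesis .
qed

text \<open>Orthogonal projection onto the span of the \<open>B a\<close> once these are
  orthonormal, a condition left to the lemmas.\<close>

definition proj :: "nat \<Rightarrow> nat \<Rightarrow> nat \<Rightarrow> (nat \<Rightarrow> nat \<Rightarrow> nat \<Rightarrow> real) \<Rightarrow> (nat \<Rightarrow> nat \<Rightarrow> real) \<Rightarrow> nat \<Rightarrow> nat \<Rightarrow> real" where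
  "proj n r m B h = (\<lambda>j i. \<Sum>a<m. dot n r (B a) h * B a j i)"

lemma dot_proj_left: "dot n r (proj n r m B g) h = (\<Sum>a<m. dot n r (B a) g * dot n r (B a) h)"
  by (simp add: proj_def dot_sum_left dot_scale_left)

text \<open>The second claim combines self-adjointness and idempotence; it lets the Gram matrix of
  projected plants be computed against the plants themselves.\<close>

lemma dot_proj:
  assumes B: "\<And>a b. a < m \<Longrightarrow> b < m \<Longrightarrow> dot n r (B a) (B b) = (if a = b then 1 else 0)"
  shows "b < m \<Longrightarrow> dot n r (B b) (proj n r m B h) = dot n r (B b) h"
    and "dot n r (proj n r m B g) (proj n r m B h) = dot n r (proj n r m B g) h"
proof -
  show *: "dot n r (B b) (proj n r m B h) = dot n r (B b) h" if "b < m" for b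
  proof -
    have "dot n r (B b) (proj n r m B h) = (\<Sum>a<m. dot n r (B a) h * dot n r (B a) (B b))"
      by (simp add: dot_commute[of n r "B b"] dot_proj_left)
    also have "\<dots> = (\<Sum>a<m. if a = b then dot n r (B a) h else 0)"
      using that by (intro sum.cong) (auto simp: B)
    finally show ?thesis using that by simp
  qed
  show "dot n r (proj n r m B g) (proj n r m B h) = dot n r (proj n r m B g) h"
    by (simp add: dot_proj_left *)
qed

text \<open>Averaging over the signs and the columns turns the projected energy of a plant into the
  trace of the projection, which is at most \<open>m\<close>.\<close>

lemma sum_dot_proj_plant:
  assumes B: "\<And>a b. a < m \<Longrightarrow> b < m \<Longrightarrow> dot n r (B a) (B b) = (if a = b then 1 else 0)"
  shows "(\<Sum>u\<in>signs r. \<Sum>j<n. dot n r (proj n r m B (plant s u j)) (plant s u j)) = 2 ^ r * s\<^sup>2 * real m"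
proof -
  have "(\<Sum>u\<in>signs r. \<Sum>j<n. dot n r (proj n r m B (plant s u j)) (plant s u j)) =
      (\<Sum>u\<in>signs r. \<Sum>j<n. \<Sum>a<m. s\<^sup>2 * (\<Sum>i<r. u i * B a j i)\<^sup>2)"
    by (simp add: dot_proj_left dot_plant power2_eq_square mult_ac)
  also have "\<dots> = (\<Sum>j<n. \<Sum>a<m. s\<^sup>2 * (\<Sum>u\<in>signs r. (\<Sum>i<r. u i * B a j i)\<^sup>2))"
    unfolding sum_distrib_left
    by (subst sum.swap, rule sum.cong[OF refl], rule sum.swap)
  also have "\<dots> = 2 ^ r * s\<^sup>2 * (\<Sum>a<m. dot n r (B a) (B a))"
    unfolding sum_signs_square dot_def sum_distrib_left
    by (subst sum.swap) (intro sum.cong refl, simp add: power2_eq_square)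
  also have "\<dots> = 2 ^ r * s\<^sup>2 * real m" by (simp add: B)
  finally show ?thesis .
qed

section \<open>Chi-square sums and the bound on the sketch dimension\<close>

lemma abs_dot_le:
  assumes "dot n r g g \<le> \<theta>" "dot n r h h \<le> \<theta>"
  shows "\<bar>dot n r g h\<bar> \<le> \<theta>"
proof -
  have "(dot n r g g + dot n r h h) / 2 \<le> (\<theta> + \<theta>) / 2"
    using assms by (intro divide_right_mono add_mono) auto
  then show ?thesis using dot_le_half[of n r g h] by simp
qed

text \<open>All exponents are at most 1/32, so every single term is already below 1/16.\<close>

lemma chi_square_sum_small:
  assumes "finite J" "card J \<le> n" and w: "\<And>j. j \<in> J \<Longrightarrow> dot n r (w j) (w j) \<le> 1 / 32"
  shows "(\<Sum>a\<in>J. \<Sum>b\<in>J. exp (dot n r (w a) (w b)) - 1) \<le> (real n)\<^sup>2 / 16"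
proof -
  have "exp (dot n r (w a) (w b)) - 1 \<le> 1 / 16" if "a \<in> J" "b \<in> J" for a b
  proof -
    have *: "dot n r (w a) (w b) \<le> 1 / 32"
      using abs_dot_le[OF w[OF that(1)] w[OF that(2)]] by simp
    have "exp (dot n r (w a) (w b)) \<le> exp (1 / 32)" using * by simp
    also have "exp (1 / 32) \<le> 1 + (1 / 32) + (1 / 32 :: real)\<^sup>2" by (rule exp_bound) auto
    finally show ?thesis by (simp add: power2_eq_square)
  qed
  then have "(\<Sum>a\<in>J. \<Sum>b\<in>J. exp (dot n r (w a) (w b)) - 1) \<le> (\<Sum>a\<in>J. \<Sum>b\<in>J. 1 / 16)"
    by (intro sum_mono)
  also have "\<dots> = (real (card J))\<^sup>2 / 16" by (simp add: power2_eq_square)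
  also have "\<dots> \<le> (real n)\<^sup>2 / 16" using assms(2) by (intro divide_right_mono power_mono) auto
  finally show ?thesis .
qed

text \<open>Here \<open>\<theta>\<close> may grow with \<open>n\<close>. Diagonal terms may be
  large, but by \<open>wp\<close> the \<open>w j\<close> behave as projected plants, so Bessel
  bounds the squares in each row of the Gram matrix by \<open>s\<^sup>2 * real r * \<theta>\<close>
  in total. Cauchy-Schwarz passes to the row sum at the cost of \<open>sqrt n\<close>, and
  \<open>exp \<theta>\<close> is the cost of linearising the exponential.\<close>

lemma chi_square_sum_large:
  assumes J: "J \<subseteq> {..<n}" and u: "u \<in> signs r" and \<theta>: "\<theta> \<ge> 0"
    and w: "\<And>j. j \<in> J \<Longrightarrow> dot n r (w j) (w j) \<le> \<theta>"
    and wp: "\<And>j j'. j \<in> J \<Longrightarrow> j' < n \<Longrightarrow> dot n r (w j) (w j') = dot n r (w j) (plant s u j')"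
    and bound: "exp \<theta> * sqrt (real n * (s\<^sup>2 * real r * \<theta>)) \<le> real n / 16"
  shows "(\<Sum>a\<in>J. \<Sum>b\<in>J. exp (dot n r (w a) (w b)) - 1) \<le> (real n)\<^sup>2 / 16"
proof -
  have fin: "finite J" using J finite_subset by blast
  have card: "card J \<le> n" using card_mono[OF _ J] by simp
  have exp_le: "exp (dot n r (w a) (w b)) - 1 \<le> exp \<theta> * \<bar>dot n r (w a) (w b)\<bar>" if "a \<in> J" "b \<in> J" for a b
  proof -
    let ?x = "dot n r (w a) (w b)"
    have *: "\<bar>?x\<bar> \<le> \<theta>"
      by (rule abs_dot_le[OF w[OF that(1)] w[OF that(2)]])
    have "1 - ?x \<le> exp (- ?x)" using exp_ge_add_one_self[of "- ?x"] by simp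
    then have "exp ?x * (1 - ?x) \<le> exp ?x * exp (- ?x)" by (intro mult_left_mono) auto
    then have "exp ?x - 1 \<le> exp ?x * ?x" by (simp add: exp_minus field_simps)
    also have "\<dots> \<le> exp ?x * \<bar>?x\<bar>" by (intro mult_left_mono) auto
    also have "\<dots> \<le> exp \<theta> * \<bar>?x\<bar>" using * by (intro mult_right_mono) auto
    finally show ?thesis .
  qed
  have row: "(\<Sum>b\<in>J. \<bar>dot n r (w a) (w b)\<bar>) \<le> sqrt (real n * (s\<^sup>2 * real r * \<theta>))" if a: "a \<in> J" for a
  proof (rule real_le_rsqrt)
    have "(\<Sum>b\<in>J. \<bar>dot n r (w a) (w b)\<bar>)\<^sup>2 = (\<Sum>b\<in>J. 1 * \<bar>dot n r (w a) (w b)\<bar>)\<^sup>2" by simp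
    also have "\<dots> \<le> (\<Sum>b\<in>J. 1\<^sup>2) * (\<Sum>b\<in>J. \<bar>dot n r (w a) (w b)\<bar>\<^sup>2)"
      by (rule Cauchy_Schwarz_ineq_sum)
    also have "\<dots> = real (card J) * (\<Sum>b\<in>J. (dot n r (w a) (w b))\<^sup>2)" by simp
    also have "\<dots> \<le> real n * (s\<^sup>2 * real r * \<theta>)"
    proof (intro mult_mono)
      have "(\<Sum>b\<in>J. (dot n r (w a) (w b))\<^sup>2) \<le> (\<Sum>b<n. (dot n r (w a) (w b))\<^sup>2)"
        using J by (intro sum_mono2) auto
      also have "\<dots> = (\<Sum>b<n. (dot n r (w a) (plant s u b))\<^sup>2)"
        by (intro sum.cong) (auto simp: wp a)
      also have "\<dots> \<le> s\<^sup>2 * real r * dot n r (w a) (w a)"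
        by (rule sum_dot_plant_square_le[OF u])
      also have "\<dots> \<le> s\<^sup>2 * real r * \<theta>" using w[OF a] by (intro mult_left_mono) auto
      finally show "(\<Sum>b\<in>J. (dot n r (w a) (w b))\<^sup>2) \<le> s\<^sup>2 * real r * \<theta>" .
    qed (use card in \<open>auto intro: sum_nonneg\<close>)
    finally show "(\<Sum>b\<in>J. \<bar>dot n r (w a) (w b)\<bar>)\<^sup>2 \<le> real n * (s\<^sup>2 * real r * \<theta>)" .
  qed
  have "(\<Sum>a\<in>J. \<Sum>b\<in>J. exp (dot n r (w a) (w b)) - 1) \<le>
      (\<Sum>a\<in>J. exp \<theta> * (\<Sum>b\<in>J. \<bar>dot n r (w a) (w b)\<bar>))"
    unfolding sum_distrib_left by (intro sum_mono exp_le)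
  also have "\<dots> \<le> (\<Sum>a\<in>J. real n / 16)"
    by (intro sum_mono order_trans[OF _ bound] mult_left_mono row) auto
  also have "\<dots> = real (card J) * (real n / 16)" by simp
  also have "\<dots> \<le> real n * (real n / 16)" using card by (intro mult_right_mono) auto
  finally show ?thesis by (simp add: power2_eq_square)
qed

text \<open>\<open>F\<close> reacts to a shift only through its inner products with the
  \<open>v l\<close>, so every plant may be replaced by its projection. For each \<open>u\<close>,
  columns of projected energy at most \<open>\<theta>\<close> fall under a chi-square bound; any
  other column gains at most 1, hence at most its energy divided by \<open>\<theta>\<close>. Summing
  over \<open>u\<close> turns the energies into a trace.\<close>

lemma sketch_dimension_ge:
  fixes F :: "(nat \<Rightarrow> nat \<Rightarrow> real) \<Rightarrow> real" and v :: "nat \<Rightarrow> nat \<Rightarrow> nat \<Rightarrow> real"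
  assumes F [measurable]: "F \<in> borel_measurable (gmat n r)" and F01: "\<And>X. 0 \<le> F X" "\<And>X. F X \<le> 1"
    and n: "n > 0" and \<theta>: "\<theta> > 0"
    and inv: "\<And>g h X. (\<And>l. l < k \<Longrightarrow> dot n r (v l) g = dot n r (v l) h) \<Longrightarrow>
      F (array_shift n r g X) = F (array_shift n r h X)"
    and regime: "\<theta> = 1 / 32 \<or> exp \<theta> * sqrt (real n * (s\<^sup>2 * real r * \<theta>)) \<le> real n / 16"
    and adv: "2 ^ r * real n / 2 \<le>
      (\<Sum>u\<in>signs r. \<Sum>j<n. (\<integral>X. F X \<partial>gmat n r) - (\<integral>X. F (array_shift n r (plant s u j) X) \<partial>gmat n r))"
  shows "real n * \<theta> \<le> 4 * s\<^sup>2 * real k"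
proof -
  obtain m B where m: "m \<le> k"
    and B: "\<And>a b. a < m \<Longrightarrow> b < m \<Longrightarrow> dot n r (B a) (B b) = (if a = b then 1 else 0)"
    and v: "\<And>l h. l < k \<Longrightarrow> (\<forall>a<m. dot n r (B a) h = 0) \<Longrightarrow> dot n r (v l) h = 0"
    using ex_orthonormal_family[of k n r v] by metis
  let ?P = "proj n r m B"
  let ?\<Delta> = "\<lambda>h. (\<integral>X. F X \<partial>gmat n r) - (\<integral>X. F (array_shift n r h X) \<partial>gmat n r)"
  interpret prob_space "gmat n r" by (rule prob_space_gmat)
  \<comment> \<open>\<open>h\<close> minus its projection is orthogonal to all \<open>B a\<close>,
    hence to all \<open>v l\<close>, so both shifts yield the same measurements.\<close>
  have \<Delta>_proj: "?\<Delta> h = ?\<Delta> (?P h)" for h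
  proof -
    have "dot n r (v l) h = dot n r (v l) (?P h)" if "l < k" for l
    proof -
      have "dot n r (v l) (\<lambda>j i. h j i - ?P h j i) = 0"
      proof (rule v[OF that], safe)
        fix a assume "a < m"
        then show "dot n r (B a) (\<lambda>j i. h j i - ?P h j i) = 0"
          using dot_proj(1)[of m n r B a h] B
          by (simp add: dot_commute[of n r "B a"] dot_diff_left)
      qed
      then show ?thesis by (simp add: dot_commute[of n r "v l"] dot_diff_left)
    qed
    then have "F (array_shift n r h X) = F (array_shift n r (?P h) X)" for X by (rule inv)
    then show ?thesis by simp
  qed
  have \<Delta>_le_1: "?\<Delta> h \<le> 1" for h
  proof -
    have "(\<integral>X. F X \<partial>gmat n r) \<le> (\<integral>X. 1 \<partial>gmat n r)"
    proof (rule integral_mono)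
      show "integrable (gmat n r) F" by (rule integrable_const_bound[of _ 1]) (use F01 in auto)
    qed (use F01 in auto)
    moreover have "0 \<le> (\<integral>X. F (array_shift n r h X) \<partial>gmat n r)"
      by (rule integral_nonneg_AE) (use F01 in auto)
    ultimately show ?thesis by (simp add: prob_space)
  qed
  have each: "(\<Sum>j<n. ?\<Delta> (plant s u j)) \<le>
      real n / 4 + (\<Sum>j<n. dot n r (?P (plant s u j)) (plant s u j)) / \<theta>" if u: "u \<in> signs r" for u
  proof -
    let ?w = "\<lambda>j. ?P (plant s u j)"
    let ?a = "\<lambda>j. dot n r (?w j) (plant s u j)"
    have a: "dot n r (?w i) (?w j) = dot n r (?w i) (plant s u j)" for i j
      by (rule dot_proj(2)) (simp add: B)
    have a_nonneg: "0 \<le> ?a j" for j using dot_self_nonneg[of n r "?w j"] by (simp add: a)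
    define J where "J = {j \<in> {..<n}. ?a j \<le> \<theta>}"
    have J: "J \<subseteq> {..<n}" "finite J" by (auto simp: J_def)
    have cJ: "card J \<le> n" using card_mono[OF _ J(1)] by simp
    have chi: "(\<Sum>i\<in>J. \<Sum>j\<in>J. exp (dot n r (?w i) (?w j)) - 1) \<le> (real n)\<^sup>2 / 16"
      using regime
    proof
      assume "\<theta> = 1 / 32"
      then show ?thesis by (intro chi_square_sum_small J cJ) (auto simp: J_def a)
    next
      assume "exp \<theta> * sqrt (real n * (s\<^sup>2 * real r * \<theta>)) \<le> real n / 16"
      then show ?thesis
        using \<theta> by (intro chi_square_sum_large[OF J(1) u, where \<theta> = \<theta> and s = s] a) (auto simp: J_def a)
    qed
    have "(\<Sum>j\<in>J. ?\<Delta> (?w j)) \<le> real n / 8 + 2 / real n * (\<Sum>i\<in>J. \<Sum>j\<in>J. exp (dot n r (?w i) (?w j)) - 1)"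
      by (rule sum_shift_advantage_le) (use F01 n J in auto)
    also have "\<dots> \<le> real n / 8 + 2 / real n * ((real n)\<^sup>2 / 16)"
      by (intro add_left_mono mult_left_mono chi) auto
    \<comment> \<open>Half of the average advantage 1/2 demanded by \<open>adv\<close>; the columns
      outside \<open>J\<close> must supply the rest.\<close>
    also have "\<dots> = real n / 4" using n by (simp add: power2_eq_square)
    finally have good: "(\<Sum>j\<in>J. ?\<Delta> (plant s u j)) \<le> real n / 4"
      by (simp only: \<Delta>_proj[symmetric])
    have "(\<Sum>j\<in>{..<n} - J. ?\<Delta> (plant s u j)) \<le> (\<Sum>j\<in>{..<n} - J. ?a j / \<theta>)"
    proof (rule sum_mono)
      fix j assume "j \<in> {..<n} - J"
      then have "1 \<le> ?a j / \<theta>" using \<theta> by (auto simp: J_def field_simps)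
      then show "?\<Delta> (plant s u j) \<le> ?a j / \<theta>" using \<Delta>_le_1 order_trans by blast
    qed
    also have "\<dots> \<le> (\<Sum>j<n. ?a j / \<theta>)"
      using a_nonneg \<theta> by (intro sum_mono2) auto
    finally have bad: "(\<Sum>j\<in>{..<n} - J. ?\<Delta> (plant s u j)) \<le> (\<Sum>j<n. ?a j) / \<theta>"
      by (simp only: sum_divide_distrib)
    show ?thesis
      using good bad sum.subset_diff[OF J(1), of "\<lambda>j. ?\<Delta> (plant s u j)"] by simp
  qed
  have "2 ^ r * real n / 2 \<le> (\<Sum>u\<in>signs r. \<Sum>j<n. ?\<Delta> (plant s u j))" by (rule adv)
  also have "\<dots> \<le> (\<Sum>u\<in>signs r. real n / 4 + (\<Sum>j<n. dot n r (?P (plant s u j)) (plant s u j)) / \<theta>)"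
    by (intro sum_mono each)
  also have "\<dots> = 2 ^ r * real n / 4 + 2 ^ r * s\<^sup>2 * real m / \<theta>"
    using sum_dot_proj_plant[of m n r B s] B
    by (simp add: sum.distrib sum_divide_distrib[symmetric])
  finally have "2 ^ r * (real n * \<theta>) \<le> 2 ^ r * (4 * s\<^sup>2 * real m)"
    using \<theta> by (simp add: field_simps)
  then have "real n * \<theta> \<le> 4 * s\<^sup>2 * real m" by simp
  also have "\<dots> \<le> 4 * s\<^sup>2 * real k" using m by (intro mult_left_mono) auto
  finally show ?thesis .
qed

section \<open>Power means and operator norms\<close>

text \<open>Young's inequality after scaling. Positive bounds \<open>A\<close> and \<open>B\<close>
  stand in for the norms, so that vanishing families need no separate case.\<close>

lemma Holder_sum_le:
  fixes y z :: "'i \<Rightarrow> real"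
  assumes a: "a > 1" and b: "b > 1" and ab: "1 / a + 1 / b = 1" and A: "A > 0" and B: "B > 0"
    and y: "(\<Sum>i\<in>I. \<bar>y i\<bar> powr a) \<le> A powr a" and z: "(\<Sum>i\<in>I. \<bar>z i\<bar> powr b) \<le> B powr b"
  shows "(\<Sum>i\<in>I. \<bar>y i * z i\<bar>) \<le> A * B"
proof -
  have "(\<Sum>i\<in>I. \<bar>y i * z i\<bar>) / (A * B) = (\<Sum>i\<in>I. (\<bar>y i\<bar> / A) * (\<bar>z i\<bar> / B))"
    by (simp add: sum_divide_distrib abs_mult)
  also have "\<dots> \<le> (\<Sum>i\<in>I. (\<bar>y i\<bar> / A) powr a / a + (\<bar>z i\<bar> / B) powr b / b)"
    using A B by (intro sum_mono Youngs_inequality a b ab) auto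
  also have "\<dots> = (\<Sum>i\<in>I. \<bar>y i\<bar> powr a) / A powr a / a + (\<Sum>i\<in>I. \<bar>z i\<bar> powr b) / B powr b / b"
    using A B by (simp add: sum.distrib powr_divide sum_divide_distrib)
  also have "\<dots> \<le> 1 / a + 1 / b"
    using y z A B a b by (intro add_mono divide_right_mono) auto
  finally have "(\<Sum>i\<in>I. \<bar>y i * z i\<bar>) / (A * B) \<le> 1" using ab by simp
  then show ?thesis using A B by (simp add: divide_le_eq)
qed

lemma powr_le_powr_imp_le:
  fixes x y q :: real
  assumes "x powr q \<le> y powr q" "q > 0" "y \<ge> 0"
  shows "x \<le> y"
  using assms powr_less_mono2[of q y x] by (meson not_less)

text \<open>After division by \<open>B\<close> all entries are at most 1 in modulus, and raising the
  exponent lowers their powers.\<close>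

lemma sum_powr_mono_exponent:
  fixes z :: "'i \<Rightarrow> real"
  assumes "finite I" and q: "0 < q" "q \<le> b" and B: "B > 0"
    and z: "(\<Sum>i\<in>I. \<bar>z i\<bar> powr q) \<le> B powr q"
  shows "(\<Sum>i\<in>I. \<bar>z i\<bar> powr b) \<le> B powr b"
proof -
  have le: "\<bar>z i\<bar> \<le> B" if "i \<in> I" for i
  proof -
    have "\<bar>z i\<bar> powr q \<le> (\<Sum>i\<in>I. \<bar>z i\<bar> powr q)"
      using \<open>finite I\<close> that by (intro member_le_sum) auto
    then have "\<bar>z i\<bar> powr q \<le> B powr q" using z by simp
    then show ?thesis using q B by (auto elim: powr_le_powr_imp_le)
  qed
  have "(\<Sum>i\<in>I. \<bar>z i\<bar> powr b) / B powr b = (\<Sum>i\<in>I. (\<bar>z i\<bar> / B) powr b)"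
    using B by (simp add: sum_divide_distrib powr_divide)
  also have "\<dots> \<le> (\<Sum>i\<in>I. (\<bar>z i\<bar> / B) powr q)"
    using B le q by (intro sum_mono powr_mono') auto
  also have "\<dots> = (\<Sum>i\<in>I. \<bar>z i\<bar> powr q) / B powr q"
    using B by (simp add: sum_divide_distrib powr_divide)
  also have "\<dots> \<le> 1" using z B by simp
  finally show ?thesis using B by (simp add: divide_le_eq)
qed

text \<open>Division by the power mean \<open>W\<close> of order \<open>t\<close> reduces the claim
  to weighted AM-GM for \<open>x powr t\<close> and 1 with weights \<open>s / t\<close> and
  \<open>1 - s / t\<close>.\<close>

lemma power_mean_sum:
  fixes w :: "nat \<Rightarrow> real"
  assumes s: "0 < s" "s \<le> t" and r: "r > 0"
  shows "(\<Sum>i<r. \<bar>w i\<bar> powr s) \<le> real r * ((\<Sum>i<r. \<bar>w i\<bar> powr t) / real r) powr (s / t)"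
proof (cases "(\<Sum>i<r. \<bar>w i\<bar> powr t) = 0")
  case True
  then have "\<forall>i<r. w i = 0" by (simp add: sum_nonneg_eq_0_iff)
  then show ?thesis using s by simp
next
  case False
  then have S: "(\<Sum>i<r. \<bar>w i\<bar> powr t) > 0" by (simp add: sum_nonneg less_le)
  define W where "W = ((\<Sum>i<r. \<bar>w i\<bar> powr t) / real r) powr (1 / t)"
  have W: "W > 0" using S r by (simp add: W_def)
  have Wt: "W powr t = (\<Sum>i<r. \<bar>w i\<bar> powr t) / real r"
    using S r s by (simp add: W_def powr_powr)
  have Ws: "W powr s = ((\<Sum>i<r. \<bar>w i\<bar> powr t) / real r) powr (s / t)"
    by (simp add: W_def powr_powr)
  have *: "x powr s \<le> s / t * x powr t + (1 - s / t)" if "x \<ge> 0" for x :: real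
  proof (cases "x = 0")
    case True
    then show ?thesis using s by simp
  next
    case False
    then show ?thesis
      using Youngs_inequality_0[of "s / t" "1 - s / t" "x powr t" 1] that s by (simp add: powr_powr)
  qed
  have "(\<Sum>i<r. \<bar>w i\<bar> powr s) / W powr s = (\<Sum>i<r. (\<bar>w i\<bar> / W) powr s)"
    using W by (simp add: sum_divide_distrib powr_divide)
  also have "\<dots> \<le> (\<Sum>i<r. s / t * (\<bar>w i\<bar> / W) powr t + (1 - s / t))"
    using W by (intro sum_mono *) auto
  also have "\<dots> = s / t * ((\<Sum>i<r. \<bar>w i\<bar> powr t) / W powr t) + real r * (1 - s / t)"
    using W by (simp add: sum.distrib sum_distrib_left sum_divide_distrib powr_divide)
  also have "\<dots> = real r"
    using S r s unfolding Wt by (simp add: field_simps)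
  finally show ?thesis using W unfolding Ws[symmetric] by (simp add: divide_le_eq)
qed

section \<open>Arrays as matrices and their operator norms\<close>

definition embed_mat :: "nat \<Rightarrow> nat \<Rightarrow> (nat \<Rightarrow> nat \<Rightarrow> real) \<Rightarrow> real mat" where
  "embed_mat n r X = mat n n (\<lambda>(i, j). if i < r then X j i else 0)"

lemma embed_carrier [simp]: "embed_mat n r X \<in> carrier_mat n n"
  by (simp add: embed_mat_def)

lemma dim_embed [simp]: "dim_row (embed_mat n r X) = n" "dim_col (embed_mat n r X) = n"
  by (simp_all add: embed_mat_def)

lemma embed_index: "i < n \<Longrightarrow> j < n \<Longrightarrow> embed_mat n r X $$ (i, j) = (if i < r then X j i else 0)"
  by (simp add: embed_mat_def)

lemma sum_lessThan_if_less:
  fixes f :: "nat \<Rightarrow> real"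
  assumes "r \<le> n"
  shows "(\<Sum>i<n. if i < r then f i else 0) = (\<Sum>i<r. f i)"
proof -
  have "{..<n} \<inter> {i. i < r} = {..<r}" using assms by auto
  then show ?thesis by (simp add: sum.If_cases)
qed

lemma embed_mult_vec_index:
  assumes "i < n" "dim_vec z = n"
  shows "(embed_mat n r X *\<^sub>v z) $ i = (if i < r then \<Sum>j<n. X j i * z $ j else 0)"
proof -
  have "(embed_mat n r X *\<^sub>v z) $ i = (\<Sum>j<n. embed_mat n r X $$ (i, j) * z $ j)"
    using assms by (simp add: scalar_prod_def lessThan_atLeast0)
  also have "\<dots> = (\<Sum>j<n. (if i < r then X j i else 0) * z $ j)"
    using assms by (intro sum.cong) (auto simp: embed_index)
  finally show ?thesis by simp
qed

lemma lp_norm_embed_mult_vec: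
  assumes "r \<le> n" "dim_vec z = n" "p > 0"
  shows "lp_norm p (embed_mat n r X *\<^sub>v z) = (\<Sum>i<r. \<bar>\<Sum>j<n. X j i * z $ j\<bar> powr p) powr (1 / p)"
proof -
  have "(\<Sum>i<n. \<bar>(embed_mat n r X *\<^sub>v z) $ i\<bar> powr p) =
      (\<Sum>i<n. if i < r then \<bar>\<Sum>j<n. X j i * z $ j\<bar> powr p else 0)"
    using assms by (intro sum.cong) (auto simp: embed_mult_vec_index simp del: index_mult_mat_vec)
  then show ?thesis
    by (simp add: lp_norm_def sum_lessThan_if_less assms(1) del: index_mult_mat_vec)
qed

lemma lp_norm_nonneg [simp]: "0 \<le> lp_norm p x"
  by (simp add: lp_norm_def)

lemma lp_norm_powr:
  assumes "p > 0"
  shows "lp_norm p x powr p = (\<Sum>i<dim_vec x. \<bar>x $ i\<bar> powr p)"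
  using assms by (simp add: lp_norm_def powr_powr sum_nonneg)

lemma lp_norm_pos:
  assumes "x \<noteq> 0\<^sub>v (dim_vec x)" 
  shows "lp_norm p x > 0"
proof -
  from assms obtain i where i: "i < dim_vec x" "x $ i \<noteq> 0"
    by (metis eq_vecI index_zero_vec(1) index_zero_vec(2))
  have "0 < (\<Sum>i<dim_vec x. \<bar>x $ i\<bar> powr p)"
    using i by (intro sum_pos2[of _ i]) auto
  then show ?thesis by (simp add: lp_norm_def)
qed

lemma abs_index_le_lp_norm:
  assumes "i < dim_vec x" "p > 0"
  shows "\<bar>x $ i\<bar> \<le> lp_norm p x"
proof -
  have "\<bar>x $ i\<bar> powr p \<le> (\<Sum>i<dim_vec x. \<bar>x $ i\<bar> powr p)"
    using assms by (intro member_le_sum) auto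
  then have "\<bar>x $ i\<bar> powr p \<le> lp_norm p x powr p" using assms by (simp add: lp_norm_powr)
  then show ?thesis using assms by (auto elim: powr_le_powr_imp_le)
qed

lemma lp_norm_unit_vec:
  assumes "j < n" "q > 0"
  shows "lp_norm q (unit_vec n j) = 1"
proof -
  have "(\<Sum>i<n. \<bar>unit_vec n j $ i\<bar> powr q) = (\<Sum>i<n. if i = j then 1 else (0 :: real))"
    using assms by (intro sum.cong) auto
  then show ?thesis using assms by (simp add: lp_norm_def)
qed

text \<open>At most \<open>r\<close> coordinates of the image are nonzero, so by power means passing
  from the Euclidean norm to the \<open>p\<close>-norm costs
  \<open>real r powr (1 / p - 1 / 2)\<close>. This is where \<open>p \<le> 2\<close> enters.\<close>

lemma op_norm_embed_le:
  assumes r: "1 \<le> r" "r \<le> n" and p: "1 \<le> p" "p \<le> 2" and q: "q > 0" and R: "R \<ge> 0"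
    and X: "\<And>z. dim_vec z = n \<Longrightarrow>
      sqrt (\<Sum>i<r. (\<Sum>j<n. X j i * z $ j)\<^sup>2) \<le> R * lp_norm q z"
  shows "op_norm q p (embed_mat n r X) \<le> real r powr (1 / p - 1 / 2) * R"
  unfolding op_norm_def
proof (rule cSUP_least)
  show "carrier_vec (dim_col (embed_mat n r X)) - {0\<^sub>v (dim_col (embed_mat n r X))} \<noteq> ({} :: real vec set)"
  proof -
    have "unit_vec n 0 \<in> carrier_vec n - {0\<^sub>v n :: real vec}"
      using r by (auto simp: unit_vec_nonzero)
    then show ?thesis by (metis dim_embed(2) empty_iff)
  qed
next
  fix z :: "real vec" assume "z \<in> carrier_vec (dim_col (embed_mat n r X)) - {0\<^sub>v (dim_col (embed_mat n r X))}"
  then have z: "dim_vec z = n" "z \<noteq> 0\<^sub>v (dim_vec z)" by auto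
  define w where "w = (\<lambda>i. \<Sum>j<n. X j i * z $ j)"
  define S where "S = (\<Sum>i<r. (w i)\<^sup>2)"
  have S: "S \<ge> 0" "(\<Sum>i<r. \<bar>w i\<bar> powr 2) = S" by (simp_all add: S_def sum_nonneg)
  have "lp_norm p (embed_mat n r X *\<^sub>v z) = (\<Sum>i<r. \<bar>w i\<bar> powr p) powr (1 / p)"
    using lp_norm_embed_mult_vec[OF r(2) z(1)] p by (simp add: w_def)
  also have "\<dots> \<le> (real r * (S / real r) powr (p / 2)) powr (1 / p)"
    using power_mean_sum[of p 2 r w] p r by (intro powr_mono2) (auto simp: S_def sum_nonneg)
  also have "\<dots> = real r powr (1 / p) * (S powr (1 / 2) / real r powr (1 / 2))"
    using p S by (simp add: powr_mult powr_powr powr_divide)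
  also have "\<dots> = real r powr (1 / p - 1 / 2) * sqrt S"
    using S by (simp add: powr_diff powr_half_sqrt)
  also have "\<dots> \<le> real r powr (1 / p - 1 / 2) * (R * lp_norm q z)"
    using X[OF z(1)] by (intro mult_left_mono) (auto simp: S_def w_def)
  finally show "lp_norm p (embed_mat n r X *\<^sub>v z) / lp_norm q z \<le> real r powr (1 / p - 1 / 2) * R"
    using lp_norm_pos[OF z(2), of q] by (simp add: divide_le_eq mult.assoc)
qed

text \<open>The test vector is the unit vector \<open>j\<close>. The column is measured in the
  1-norm, where adding a sign vector can be controlled entry by entry; nothing is lost when its
  entries have equal modulus.\<close>

lemma op_norm_embed_ge:
  assumes r: "1 \<le> r" "r \<le> n" and p: "1 \<le> p" and q: "q > 0" and j: "j < n"
  shows "real r powr (1 / p - 1) * (\<Sum>i<r. \<bar>X j i\<bar>) \<le> op_norm q p (embed_mat n r X)"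
proof -
  define C where "C = (\<Sum>i<r. \<Sum>j<n. \<bar>X j i\<bar>)"
  have C: "C \<ge> 0" by (simp add: C_def sum_nonneg)
  let ?Z = "carrier_vec (dim_col (embed_mat n r X)) - {0\<^sub>v (dim_col (embed_mat n r X))} :: real vec set"
  let ?f = "\<lambda>z. lp_norm p (embed_mat n r X *\<^sub>v z) / lp_norm q z"
  \<comment> \<open>A real-valued \<open>SUP\<close> dominates its elements only if they are bounded
    above. The crude bound uses that no entry of \<open>z\<close> exceeds the
    \<open>q\<close>-norm.\<close>
  have "bdd_above (?f ` ?Z)"
  proof (rule bdd_aboveI2)
    fix z assume "z \<in> ?Z"
    then have z: "dim_vec z = n" "z \<noteq> 0\<^sub>v (dim_vec z)" by auto
    let ?Q = "lp_norm q z"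
    have Q: "?Q > 0" by (rule lp_norm_pos[OF z(2)])
    have "\<bar>\<Sum>j<n. X j i * z $ j\<bar> \<le> C * ?Q" if "i < r" for i
    proof -
      have "\<bar>\<Sum>j<n. X j i * z $ j\<bar> \<le> (\<Sum>j<n. \<bar>X j i\<bar> * ?Q)"
        using z q abs_index_le_lp_norm[of _ z q]
        by (intro order_trans[OF sum_abs] sum_mono) (auto simp: abs_mult intro!: mult_left_mono)
      also have "\<dots> = (\<Sum>j<n. \<bar>X j i\<bar>) * ?Q" by (simp add: sum_distrib_right)
      also have "(\<Sum>j<n. \<bar>X j i\<bar>) \<le> C"
        unfolding C_def using that by (intro member_le_sum) (auto intro: sum_nonneg)
      finally show ?thesis using Q by (simp add: mult_right_mono)
    qed
    then have "(\<Sum>i<r. \<bar>\<Sum>j<n. X j i * z $ j\<bar> powr p) \<le> (\<Sum>i<r. (C * ?Q) powr p)"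
      using p by (intro sum_mono powr_mono2) auto
    then have "lp_norm p (embed_mat n r X *\<^sub>v z) \<le> (real r * (C * ?Q) powr p) powr (1 / p)"
      using lp_norm_embed_mult_vec[OF r(2) z(1), of p X] p
      by (auto intro!: powr_mono2 sum_nonneg)
    also have "\<dots> = real r powr (1 / p) * C * ?Q"
      using p C Q by (simp add: powr_mult powr_powr)
    finally show "?f z \<le> real r powr (1 / p) * C" using Q by (simp add: divide_le_eq)
  qed
  moreover have "unit_vec n j \<in> ?Z" using j by (auto simp: unit_vec_nonzero)
  ultimately have "?f (unit_vec n j) \<le> op_norm q p (embed_mat n r X)"
    unfolding op_norm_def by (intro cSUP_upper)
  moreover have "?f (unit_vec n j) = (\<Sum>i<r. \<bar>X j i\<bar> powr p) powr (1 / p)"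
  proof -
    have "(\<Sum>j'<n. X j' i * unit_vec n j $ j') = X j i" for i
    proof -
      have "(\<Sum>j'<n. X j' i * unit_vec n j $ j') = (\<Sum>j'<n. if j' = j then X j i else 0)"
        using j by (intro sum.cong) auto
      then show ?thesis using j by simp
    qed
    then show ?thesis
      using lp_norm_embed_mult_vec[OF r(2), of "unit_vec n j" p X] p lp_norm_unit_vec[OF j q] by simp
  qed
  moreover have "(\<Sum>i<r. \<bar>X j i\<bar>) \<le> real r powr (1 - 1 / p) * (\<Sum>i<r. \<bar>X j i\<bar> powr p) powr (1 / p)"
  proof -
    have "(\<Sum>i<r. \<bar>X j i\<bar>) \<le> real r * ((\<Sum>i<r. \<bar>X j i\<bar> powr p) / real r) powr (1 / p)"
      using power_mean_sum[of 1 p r "X j"] p r by simp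
    also have "\<dots> = real r powr (1 - 1 / p) * (\<Sum>i<r. \<bar>X j i\<bar> powr p) powr (1 / p)"
      using r by (simp add: powr_divide powr_diff sum_nonneg)
    finally show ?thesis .
  qed
  then have "real r powr (1 / p - 1) * (\<Sum>i<r. \<bar>X j i\<bar>) \<le>
      real r powr (1 / p - 1) * (real r powr (1 - 1 / p) * (\<Sum>i<r. \<bar>X j i\<bar> powr p) powr (1 / p))"
    by (intro mult_left_mono) auto
  then have "real r powr (1 / p - 1) * (\<Sum>i<r. \<bar>X j i\<bar>) \<le> (\<Sum>i<r. \<bar>X j i\<bar> powr p) powr (1 / p)"
    using r by (simp add: mult.assoc[symmetric] powr_add[symmetric])
  ultimately show ?thesis by linarith
qed

section \<open>Concentration of Gaussian arrays on a grid\<close>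

definition lin :: "nat \<Rightarrow> (nat \<Rightarrow> real) \<Rightarrow> (nat \<Rightarrow> real) \<Rightarrow> real" where
  "lin r x \<xi> = (\<Sum>i<r. x i * \<xi> i)"

lemma measurable_lin [measurable]: "lin r x \<in> borel_measurable (gvec r)"
  unfolding lin_def by measurable

text \<open>The coefficient 3/8 leaves \<open>- t\<^sup>2 / 8\<close> in the exponent, a normal
  density of standard deviation 2 up to the factor 2.\<close>

lemma nn_integral_gauss_exp_square: "(\<integral>\<^sup>+t. ennreal (exp (3 / 8 * t\<^sup>2)) \<partial>gauss) = 2"
proof -
  have *: "std_normal_density t * exp (3 / 8 * t\<^sup>2) = 2 * normal_density 0 2 t" for t
  proof -
    have "exp (- t\<^sup>2 / 2) * exp (3 / 8 * t\<^sup>2) = exp (- t\<^sup>2 / 8)"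
      unfolding exp_add[symmetric] by simp
    moreover have "sqrt (2 * pi * 2\<^sup>2) = sqrt (2 * pi) * 2"
      by (subst real_sqrt_mult) (simp del: real_sqrt_mult)
    ultimately show ?thesis by (simp add: std_normal_density_def normal_density_def)
  qed
  have "(\<integral>\<^sup>+t. ennreal (exp (3 / 8 * t\<^sup>2)) \<partial>gauss) = (\<integral>\<^sup>+t. 2 * ennreal (normal_density 0 2 t) \<partial>lborel)"
  proof (subst nn_integral_gauss)
    have "ennreal (std_normal_density t) * ennreal (exp (3 / 8 * t\<^sup>2)) = 2 * ennreal (normal_density 0 2 t)" for t
      unfolding ennreal_mult[OF normal_density_nonneg exp_ge_zero, symmetric] * by (simp add: ennreal_mult)
    then show "(\<integral>\<^sup>+t. ennreal (std_normal_density t) * ennreal (exp (3 / 8 * t\<^sup>2)) \<partial>lborel) =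
        (\<integral>\<^sup>+t. 2 * ennreal (normal_density 0 2 t) \<partial>lborel)"
      by (simp only:)
  qed simp
  then show ?thesis by (simp add: nn_integral_cmult nn_integral_normal_density)
qed

text \<open>The square is linearised with an independent Gaussian \<open>t\<close>:
  \<open>exp (3 y\<^sup>2 / 8) = E exp (t y \<surd>3 / 2)\<close>.\<close>

lemma nn_integral_gvec_exp_square:
  assumes "(\<Sum>i<r. (x i)\<^sup>2) \<le> 1"
  shows "(\<integral>\<^sup>+\<xi>. ennreal (exp (3 / 8 * (lin r x \<xi>)\<^sup>2)) \<partial>gvec r) \<le> 2"
proof -
  interpret G: prob_space gauss by (rule prob_space_gauss)
  interpret V: prob_space "gvec r" by (rule prob_space_gvec)
  interpret pair_sigma_finite gauss "gvec r" ..
  have "(\<integral>\<^sup>+\<xi>. ennreal (exp (3 / 8 * (lin r x \<xi>)\<^sup>2)) \<partial>gvec r) =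
      (\<integral>\<^sup>+\<xi>. (\<integral>\<^sup>+t. ennreal (exp (sqrt 3 / 2 * lin r x \<xi> * t)) \<partial>gauss) \<partial>gvec r)"
    unfolding nn_integral_gauss_exp by (simp add: power_mult_distrib power_divide)
  also have "\<dots> = (\<integral>\<^sup>+t. (\<integral>\<^sup>+\<xi>. ennreal (exp (sqrt 3 / 2 * lin r x \<xi> * t)) \<partial>gvec r) \<partial>gauss)"
    by (rule Fubini') measurable
  also have "\<dots> = (\<integral>\<^sup>+t. ennreal (exp (3 / 8 * t\<^sup>2 * (\<Sum>i<r. (x i)\<^sup>2))) \<partial>gauss)"
  proof (rule nn_integral_cong)
    fix t
    have "(\<integral>\<^sup>+\<xi>. ennreal (exp (sqrt 3 / 2 * lin r x \<xi> * t)) \<partial>gvec r) =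
        (\<integral>\<^sup>+\<xi>. ennreal (exp (\<Sum>i<r. (sqrt 3 / 2 * t * x i) * \<xi> i)) \<partial>gvec r)"
      by (simp add: lin_def sum_distrib_left sum_distrib_right mult_ac)
    also have "\<dots> = ennreal (exp ((\<Sum>i<r. (sqrt 3 / 2 * t * x i)\<^sup>2) / 2))"
      by (rule nn_integral_gvec_exp)
    also have "(\<Sum>i<r. (sqrt 3 / 2 * t * x i)\<^sup>2) / 2 = 3 / 8 * t\<^sup>2 * (\<Sum>i<r. (x i)\<^sup>2)"
      by (simp add: power_mult_distrib power_divide sum_distrib_left sum_divide_distrib)
    finally show "(\<integral>\<^sup>+\<xi>. ennreal (exp (sqrt 3 / 2 * lin r x \<xi> * t)) \<partial>gvec r) =
        ennreal (exp (3 / 8 * t\<^sup>2 * (\<Sum>i<r. (x i)\<^sup>2)))" .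
  qed
  also have "\<dots> \<le> (\<integral>\<^sup>+t. ennreal (exp (3 / 8 * t\<^sup>2)) \<partial>gauss)"
    using assms by (intro nn_integral_mono ennreal_leI) (auto intro!: mult_left_le)
  finally show ?thesis unfolding nn_integral_gauss_exp_square .
qed

text \<open>Isolating the summand 1 keeps the moment close to 1 when \<open>c\<close> is small: over
  \<open>n\<close> independent columns the factors multiply to at most
  \<open>exp (2 * c * n)\<close>.\<close>

lemma nn_integral_gvec_exp_le:
  assumes x: "(\<Sum>i<r. (x i)\<^sup>2) \<le> 1" and c: "c \<ge> 0"
    and \<phi>: "\<And>y. exp (\<phi> y) \<le> 1 + c * exp (3 / 8 * y\<^sup>2)"
  shows "(\<integral>\<^sup>+\<xi>. ennreal (exp (\<phi> (lin r x \<xi>))) \<partial>gvec r) \<le> ennreal (1 + 2 * c)"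
proof -
  interpret prob_space "gvec r" by (rule prob_space_gvec)
  have "(\<integral>\<^sup>+\<xi>. ennreal (exp (\<phi> (lin r x \<xi>))) \<partial>gvec r) \<le>
      (\<integral>\<^sup>+\<xi>. 1 + ennreal c * ennreal (exp (3 / 8 * (lin r x \<xi>)\<^sup>2)) \<partial>gvec r)"
    using c \<phi> by (intro nn_integral_mono)
      (simp add: ennreal_mult[symmetric] ennreal_1[symmetric] ennreal_plus[symmetric] del: ennreal_1 ennreal_plus)
  also have "\<dots> = 1 + ennreal c * (\<integral>\<^sup>+\<xi>. ennreal (exp (3 / 8 * (lin r x \<xi>)\<^sup>2)) \<partial>gvec r)"
    by (simp add: nn_integral_add nn_integral_cmult emeasure_space_1)
  also have "\<dots> \<le> 1 + ennreal c * 2"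
    by (intro add_left_mono mult_left_mono nn_integral_gvec_exp_square x) simp
  also have "\<dots> = ennreal (1 + 2 * c)"
    using c by (simp add: ennreal_mult'' ennreal_plus mult.commute)
  finally show ?thesis .
qed

text \<open>Chernoff bound: Markov's inequality for the exponential of the sum, then independence of
  the columns. The usual free parameter is absorbed into \<open>\<phi>\<close>.\<close>

lemma prob_gmat_sum_ge:
  assumes \<phi> [measurable]: "\<phi> \<in> borel_measurable borel" and c: "c \<ge> 0"
    and int: "(\<integral>\<^sup>+\<xi>. ennreal (exp (\<phi> (lin r x \<xi>))) \<partial>gvec r) \<le> ennreal (1 + c)"
  shows "measure (gmat n r) {X \<in> space (gmat n r). t \<le> (\<Sum>j<n. \<phi> (lin r x (X j)))} \<le> exp (real n * c - t)"
proof -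
  interpret prob_space "gmat n r" by (rule prob_space_gmat)
  interpret P: product_sigma_finite "\<lambda>_. gvec r"
    by (simp add: product_sigma_finite_def prob_space_gvec prob_space_imp_sigma_finite)
  let ?A = "{X \<in> space (gmat n r). t \<le> (\<Sum>j<n. \<phi> (lin r x (X j)))}"
  have S [measurable]: "(\<lambda>X. \<Sum>j<n. \<phi> (lin r x (X j))) \<in> borel_measurable (gmat n r)"
    by measurable
  have "ennreal (measure (gmat n r) ?A) = (\<integral>\<^sup>+X. indicator ?A X \<partial>gmat n r)"
    by (simp add: emeasure_eq_measure[symmetric])
  also have "\<dots> \<le> (\<integral>\<^sup>+X. ennreal (exp (- t)) * (\<Prod>j\<in>{..<n}. ennreal (exp (\<phi> (lin r x (X j))))) \<partial>gmat n r)"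
  proof (rule nn_integral_mono)
    fix X
    have "indicator ?A X \<le> ennreal (exp (- t) * exp (\<Sum>j<n. \<phi> (lin r x (X j))))"
      by (auto simp: indicator_def exp_add[symmetric])
    then show "indicator ?A X \<le> ennreal (exp (- t)) * (\<Prod>j\<in>{..<n}. ennreal (exp (\<phi> (lin r x (X j)))))"
      by (simp add: prod_ennreal exp_sum ennreal_mult[symmetric] prod_nonneg)
  qed
  also have "\<dots> = ennreal (exp (- t)) * (\<integral>\<^sup>+X. (\<Prod>j\<in>{..<n}. ennreal (exp (\<phi> (lin r x (X j))))) \<partial>gmat n r)"
    by (rule nn_integral_cmult) measurable
  also have "\<dots> = ennreal (exp (- t)) * (\<Prod>j\<in>{..<n}. \<integral>\<^sup>+\<xi>. ennreal (exp (\<phi> (lin r x \<xi>))) \<partial>gvec r)"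
    unfolding gmat_def by (subst P.product_nn_integral_prod) auto
  also have "\<dots> \<le> ennreal (exp (- t)) * (\<Prod>j\<in>{..<n}. ennreal (exp c))"
  proof (intro mult_left_mono prod_mono_ennreal)
    have "ennreal (1 + c) \<le> ennreal (exp c)" by (intro ennreal_leI) simp
    then show "(\<integral>\<^sup>+\<xi>. ennreal (exp (\<phi> (lin r x \<xi>))) \<partial>gvec r) \<le> ennreal (exp c)"
      using int by (rule order_trans[rotated])
  qed auto
  also have "\<dots> = ennreal (exp (real n * c - t))"
    by (simp add: ennreal_power ennreal_mult[symmetric] exp_of_nat_mult[symmetric] exp_add[symmetric])
  finally show ?thesis by (simp add: ennreal_le_iff)
qed

section \<open>Heavy and light coordinates of a Gaussian vector\<close>

definition heavy :: "real \<Rightarrow> real \<Rightarrow> real" where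
  "heavy \<tau> y = (if y\<^sup>2 > \<tau> then y\<^sup>2 else 0)"

text \<open>The weight dominates every power \<open>\<bar>y\<bar> powr a\<close> with
  \<open>a \<ge> 2\<close> up to a constant, so that one event serves all exponents. The cutoff
  makes it bounded, hence with finite exponential moments.\<close>

definition light :: "real \<Rightarrow> real \<Rightarrow> real" where
  "light \<tau> y = (if y\<^sup>2 \<le> \<tau> then exp (y\<^sup>2 / 16) else 0)"

lemma measurable_heavy [measurable]: "heavy \<tau> \<in> borel_measurable borel"
  unfolding heavy_def by measurable

lemma measurable_light [measurable]: "light \<tau> \<in> borel_measurable borel"
  unfolding light_def by measurable

text \<open>At this threshold the expected number of heavy coordinates is of order \<open>r\<close>, while light
  coordinates contribute at most \<open>\<surd>(n / r)\<close> each to the sum of \<open>exp (y\<^sup>2 / 16)\<close>.\<close>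

definition threshold :: "nat \<Rightarrow> nat \<Rightarrow> real" where
  "threshold n r = 8 * ln (real n / real r)"

text \<open>Above the threshold \<open>y\<^sup>2 / 4\<close> is at most
  \<open>3 / 8 * y\<^sup>2 - ?\<tau> / 8\<close>, and \<open>exp (- ?\<tau> / 8)\<close> is
  \<open>r / n\<close>. The moments therefore cost only \<open>2 * r\<close> against the level
  \<open>64 * r / 4\<close>.\<close>

lemma prob_heavy:
  assumes r: "1 \<le> r" "r \<le> n" and x: "(\<Sum>i<r. (x i)\<^sup>2) \<le> 1"
  shows "measure (gmat n r) {X \<in> space (gmat n r). 64 * real r \<le> (\<Sum>j<n. heavy (threshold n r) (lin r x (X j)))}
    \<le> exp (- 14 * real r)"
proof -
  let ?\<tau> = "threshold n r"
  let ?\<phi> = "\<lambda>y. heavy ?\<tau> y / 4"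
  let ?c = "real r / real n"
  have e: "exp (- ?\<tau> / 8) = ?c" using r by (simp add: threshold_def exp_minus)
  have "exp (?\<phi> y) \<le> 1 + ?c * exp (3 / 8 * y\<^sup>2)" for y
  proof (cases "y\<^sup>2 > ?\<tau>")
    case True
    then have "exp (?\<phi> y) \<le> exp (- ?\<tau> / 8 + 3 / 8 * y\<^sup>2)" by (simp add: heavy_def)
    also have "\<dots> = ?c * exp (3 / 8 * y\<^sup>2)" by (simp only: exp_add e)
    finally show ?thesis by simp
  qed (simp add: heavy_def)
  then have "(\<integral>\<^sup>+\<xi>. ennreal (exp (?\<phi> (lin r x \<xi>))) \<partial>gvec r) \<le> ennreal (1 + 2 * ?c)"
    by (intro nn_integral_gvec_exp_le x) auto
  then have "measure (gmat n r) {X \<in> space (gmat n r). 16 * real r \<le> (\<Sum>j<n. ?\<phi> (lin r x (X j)))}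
      \<le> exp (real n * (2 * ?c) - 16 * real r)"
    by (intro prob_gmat_sum_ge) auto
  also have "real n * (2 * ?c) - 16 * real r = - 14 * real r" using r by simp
  finally show ?thesis by (simp add: sum_divide_distrib[symmetric] algebra_simps)
qed

text \<open>Division by the cap \<open>b\<close> brings the weight into [0, 1], where
  \<open>exp t \<le> 1 + 2 * t\<close>. The Chernoff exponent becomes \<open>- 12 * (n / b)\<close>,
  and \<open>r * b = sqrt (r * n) \<le> n\<close> compares it with \<open>r\<close>.\<close>

lemma prob_light:
  assumes r: "1 \<le> r" "r \<le> n" and x: "(\<Sum>i<r. (x i)\<^sup>2) \<le> 1"
  shows "measure (gmat n r) {X \<in> space (gmat n r). 16 * real n \<le> (\<Sum>j<n. light (threshold n r) (lin r x (X j)))}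
    \<le> exp (- 12 * real r)"
proof -
  let ?\<tau> = "threshold n r"
  define b where "b = sqrt (real n / real r)"
  have b: "b \<ge> 1" using r by (simp add: b_def)
  let ?\<phi> = "\<lambda>y. light ?\<tau> y / b"
  have e: "exp (?\<tau> / 16) = b"
  proof -
    have "exp (?\<tau> / 16) = exp (ln (real n / real r) / 2)" by (simp add: threshold_def)
    also have "\<dots> = b" using r by (simp add: b_def ln_sqrt[symmetric])
    finally show ?thesis .
  qed
  have "exp (?\<phi> y) \<le> 1 + 2 / b * exp (3 / 8 * y\<^sup>2)" for y
  proof (cases "y\<^sup>2 \<le> ?\<tau>")
    case True
    then have *: "light ?\<tau> y = exp (y\<^sup>2 / 16)" "light ?\<tau> y \<le> b"
      by (simp_all add: light_def e[symmetric])
    let ?t = "exp (y\<^sup>2 / 16) / b"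
    have t: "0 \<le> ?t" "?t \<le> 1" using * b by simp_all
    have "exp ?t \<le> 1 + ?t + ?t\<^sup>2" using t by (intro exp_bound)
    also have "?t\<^sup>2 \<le> ?t" using mult_left_le[OF t(2) t(1)] by (simp only: power2_eq_square)
    also have "1 + ?t + ?t = 1 + 2 / b * exp (y\<^sup>2 / 16)" by simp
    also have "\<dots> \<le> 1 + 2 / b * exp (3 / 8 * y\<^sup>2)"
      using b by (intro add_left_mono mult_left_mono) auto
    finally show ?thesis by (simp add: *)
  next
    case False
    then show ?thesis using b by (simp add: light_def)
  qed
  then have "(\<integral>\<^sup>+\<xi>. ennreal (exp (?\<phi> (lin r x \<xi>))) \<partial>gvec r) \<le> ennreal (1 + 2 * (2 / b))"
    using b by (intro nn_integral_gvec_exp_le x) auto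
  then have "measure (gmat n r) {X \<in> space (gmat n r). 16 * real n / b \<le> (\<Sum>j<n. ?\<phi> (lin r x (X j)))}
      \<le> exp (real n * (2 * (2 / b)) - 16 * real n / b)"
    using b by (intro prob_gmat_sum_ge) auto
  also have "real n * (2 * (2 / b)) - 16 * real n / b = - 12 * (real n / b)"
    using b by (simp add: field_simps)
  also have "exp (- 12 * (real n / b)) \<le> exp (- 12 * real r)"
  proof -
    have "real r * b = sqrt (real r * real n)"
      using r by (simp add: b_def real_sqrt_divide real_sqrt_mult field_simps)
    also have "\<dots> \<le> sqrt (real n * real n)"
      using r by (intro real_sqrt_le_mono mult_right_mono) auto
    finally have "real r * b \<le> real n" by simp
    then show ?thesis using b by (simp add: field_simps)
  qed
  finally show ?thesis
    using b by (simp add: sum_divide_distrib[symmetric] divide_le_cancel)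
qed

text \<open>The points \<open>grid_vec r g\<close> form a net of the unit ball with spacing
  \<open>1 / (2 \<surd>r)\<close>, hence of covering radius at most \<open>1 / 2\<close>.\<close>

definition grid :: "nat \<Rightarrow> (nat \<Rightarrow> int) set" where
  "grid r = {g \<in> PiE {..<r} (\<lambda>_. {- 2 * int r..2 * int r}). (\<Sum>i<r. (real_of_int (g i))\<^sup>2) \<le> 4 * real r}"

definition grid_vec :: "nat \<Rightarrow> (nat \<Rightarrow> int) \<Rightarrow> nat \<Rightarrow> real" where
  "grid_vec r g i = real_of_int (g i) / (2 * sqrt (real r))"

lemma finite_grid [simp]: "finite (grid r)"
  unfolding grid_def by (rule finite_subset[of _ "PiE {..<r} (\<lambda>_. {- 2 * int r..2 * int r})"])
    (auto intro!: finite_PiE)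

lemma sum_grid_vec_square_le:
  assumes "r \<ge> 1" "g \<in> grid r"
  shows "(\<Sum>i<r. (grid_vec r g i)\<^sup>2) \<le> 1"
proof -
  have "(\<Sum>i<r. (grid_vec r g i)\<^sup>2) = (\<Sum>i<r. (real_of_int (g i))\<^sup>2) / (4 * real r)"
    by (simp add: grid_vec_def power_divide power_mult_distrib sum_divide_distrib)
  also have "\<dots> \<le> 1" using assms by (simp add: grid_def divide_le_eq)
  finally show ?thesis .
qed

lemma sum_exp_neg_square_le: "(\<Sum>z\<in>{- int m..int m}. exp (- (real_of_int z)\<^sup>2)) \<le> 3"
proof -
  \<comment> \<open>The correction term makes the induction a geometric series, since
    \<open>exp (- m\<^sup>2)\<close> is at most \<open>(1 / 2) ^ m\<close>.\<close>
  have "(\<Sum>z\<in>{- int m..int m}. exp (- (real_of_int z)\<^sup>2)) \<le> 3 - 2 * (1 / 2) ^ m"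
  proof (induction m)
    case 0
    then show ?case by simp
  next
    case (Suc m)
    have eq: "{- int (Suc m)..int (Suc m)} = insert (int (Suc m)) (insert (- int (Suc m)) {- int m..int m})"
      by auto
    have "exp (- (real (Suc m))\<^sup>2) \<le> exp (- real (Suc m))"
      by (simp add: power2_eq_square algebra_simps)
    also have "\<dots> = exp (- 1) ^ Suc m"
      by (simp only: exp_of_nat_mult[symmetric]) simp
    also have "\<dots> \<le> (1 / 2) ^ Suc m"
    proof (rule power_mono)
      have "2 \<le> exp (1 :: real)" using exp_ge_add_one_self[of 1] by simp
      then show "exp (- 1) \<le> 1 / (2 :: real)" by (simp add: exp_minus field_simps)
    qed simp
    finally have e: "exp (- (real (Suc m))\<^sup>2) \<le> (1 / 2) ^ Suc m" .
    have "(\<Sum>z\<in>{- int (Suc m)..int (Suc m)}. exp (- (real_of_int z)\<^sup>2)) =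
        2 * exp (- (real (Suc m))\<^sup>2) + (\<Sum>z\<in>{- int m..int m}. exp (- (real_of_int z)\<^sup>2))"
    proof -
      have "(- 1 - real m)\<^sup>2 = (1 + real m)\<^sup>2" by (simp add: power2_eq_square algebra_simps)
      then show ?thesis unfolding eq by (subst sum.insert; simp)+
    qed
    also have "\<dots> \<le> 2 * (1 / 2) ^ Suc m + (3 - 2 * (1 / 2) ^ m)"
      using e Suc.IH by linarith
    finally show ?case by simp
  qed
  also have "\<dots> \<le> 3" by simp
  finally show ?thesis .
qed

text \<open>Every grid point has weight at least 1 under \<open>exp (4 * real r)\<close> times the
  product of the \<open>exp (- (g i)\<^sup>2)\<close>, and over the whole box this weight factorises
  into one-dimensional theta sums. Counting the box itself would be superexponential in
  \<open>r\<close>, too much for the union bound.\<close>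

lemma card_grid_le: "real (card (grid r)) \<le> exp (6 * real r)"
proof -
  let ?P = "PiE {..<r} (\<lambda>_. {- 2 * int r..2 * int r})"
  have fin: "finite ?P" by (intro finite_PiE) auto
  have "real (card (grid r)) = (\<Sum>g\<in>grid r. 1)" by simp
  also have "\<dots> \<le> (\<Sum>g\<in>grid r. exp (4 * real r) * (\<Prod>i<r. exp (- (real_of_int (g i))\<^sup>2)))"
  proof (rule sum_mono)
    fix g assume "g \<in> grid r"
    then have "0 \<le> 4 * real r + (\<Sum>i<r. - (real_of_int (g i))\<^sup>2)"
      by (simp add: grid_def sum_negf)
    then show "1 \<le> exp (4 * real r) * (\<Prod>i<r. exp (- (real_of_int (g i))\<^sup>2))"
      by (simp add: exp_sum[symmetric] exp_add[symmetric])
  qed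
  also have "\<dots> \<le> (\<Sum>g\<in>?P. exp (4 * real r) * (\<Prod>i<r. exp (- (real_of_int (g i))\<^sup>2)))"
    using fin by (intro sum_mono2) (auto simp only: grid_def intro!: mult_nonneg_nonneg prod_nonneg exp_ge_zero)
  also have "\<dots> = exp (4 * real r) * (\<Prod>i<r. \<Sum>z\<in>{- 2 * int r..2 * int r}. exp (- (real_of_int z)\<^sup>2))"
    unfolding sum_distrib_left[symmetric] by (subst prod_sum_PiE) auto
  also have "\<dots> \<le> exp (4 * real r) * (\<Prod>i<r. exp 2)"
  proof (intro mult_left_mono prod_mono conjI)
    have "(\<Sum>z\<in>{- 2 * int r..2 * int r}. exp (- (real_of_int z)\<^sup>2)) \<le> 3"
      using sum_exp_neg_square_le[of "2 * r"] by simp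
    also have "3 \<le> exp (2 :: real)" using exp_ge_add_one_self[of 2] by simp
    finally show "(\<Sum>z\<in>{- 2 * int r..2 * int r}. exp (- (real_of_int z)\<^sup>2)) \<le> exp 2" .
  qed (auto intro: sum_nonneg)
  also have "\<dots> = exp (6 * real r)"
    by (simp add: exp_of_nat_mult[symmetric] exp_add[symmetric])
  finally show ?thesis .
qed

definition tame :: "nat \<Rightarrow> nat \<Rightarrow> (nat \<Rightarrow> nat \<Rightarrow> real) \<Rightarrow> bool" where
  "tame n r X \<longleftrightarrow> (\<forall>g\<in>grid r.
     (\<Sum>j<n. heavy (threshold n r) (lin r (grid_vec r g) (X j))) < 64 * real r \<and>
     (\<Sum>j<n. light (threshold n r) (lin r (grid_vec r g) (X j))) < 16 * real n)"

lemma measurable_tame [measurable]: "Measurable.pred (gmat n r) (tame n r)"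
  unfolding tame_def by measurable

text \<open>Union bound: \<open>exp (6 * real r)\<close> grid points against two tails of at most
  \<open>exp (- 12 * real r)\<close> each.\<close>

lemma prob_not_tame:
  assumes r: "1 \<le> r" "r \<le> n"
  shows "measure (gmat n r) {X \<in> space (gmat n r). \<not> tame n r X} \<le> 1 / 12"
proof -
  interpret prob_space "gmat n r" by (rule prob_space_gmat)
  let ?M = "gmat n r"
  let ?h = "\<lambda>g. {X \<in> space ?M. 64 * real r \<le> (\<Sum>j<n. heavy (threshold n r) (lin r (grid_vec r g) (X j)))}"
  let ?l = "\<lambda>g. {X \<in> space ?M. 16 * real n \<le> (\<Sum>j<n. light (threshold n r) (lin r (grid_vec r g) (X j)))}"
  have meas: "?h g \<in> sets ?M" "?l g \<in> sets ?M" for g by measurable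
  have "measure ?M {X \<in> space ?M. \<not> tame n r X} = measure ?M (\<Union>g\<in>grid r. ?h g \<union> ?l g)"
    by (intro arg_cong[where f = "measure ?M"]) (auto simp: tame_def not_less)
  also have "\<dots> \<le> (\<Sum>g\<in>grid r. measure ?M (?h g \<union> ?l g))"
    using meas by (intro finite_measure_subadditive_finite) auto
  also have "\<dots> \<le> (\<Sum>g\<in>grid r. exp (- 12 * real r) + exp (- 12 * real r))"
  proof (rule sum_mono)
    fix g assume g: "g \<in> grid r"
    have "measure ?M (?h g \<union> ?l g) \<le> measure ?M (?h g) + measure ?M (?l g)"
      using meas by (intro measure_Un_le) auto
    also have "\<dots> \<le> exp (- 14 * real r) + exp (- 12 * real r)"
      using r g sum_grid_vec_square_le by (intro add_mono prob_heavy prob_light) auto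
    also have "\<dots> \<le> exp (- 12 * real r) + exp (- 12 * real r)" by simp
    finally show "measure ?M (?h g \<union> ?l g) \<le> exp (- 12 * real r) + exp (- 12 * real r)" .
  qed
  also have "\<dots> = real (card (grid r)) * (2 * exp (- 12 * real r))" by simp
  also have "\<dots> \<le> exp (6 * real r) * (2 * exp (- 12 * real r))"
    by (intro mult_right_mono card_grid_le) simp
  also have "\<dots> = 2 * exp (- 6 * real r)" by (simp add: exp_add[symmetric])
  also have "\<dots> \<le> 2 * exp (- 6)" using r by simp
  also have "\<dots> \<le> 1 / 12"
  proof -
    have "exp (6::real) \<ge> 24"
      using exp_lower_Taylor_quadratic[of 6] by simp
    then show ?thesis by (simp add: exp_minus field_simps)
  qed
  finally show ?thesis .
qed

text \<open>Rounding towards zero instead of to the nearest integer never increases the modulus, so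
  that rounded points of the ball stay in \<open>grid\<close>.\<close>

lemma trunc_toward_zero:
  fixes t :: real
  obtains g :: int where "\<bar>real_of_int g\<bar> \<le> \<bar>t\<bar>" "\<bar>real_of_int g - t\<bar> \<le> 1"
proof (cases "t \<ge> 0")
  case True
  then have "\<bar>real_of_int \<lfloor>t\<rfloor>\<bar> \<le> \<bar>t\<bar>" "\<bar>real_of_int \<lfloor>t\<rfloor> - t\<bar> \<le> 1"
    by (auto, linarith+)
  then show ?thesis by (rule that)
next
  case False
  have "\<lceil>t\<rceil> \<le> 0" using False by (simp add: ceiling_le_zero)
  then have "real_of_int \<lceil>t\<rceil> \<le> 0" by simp
  then have "\<bar>real_of_int \<lceil>t\<rceil>\<bar> \<le> \<bar>t\<bar>"
    using False ceiling_correct[of t] by linarith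
  moreover have "\<bar>real_of_int \<lceil>t\<rceil> - t\<bar> \<le> 1"
    using ceiling_correct[of t] by linarith
  ultimately show ?thesis by (rule that)
qed

lemma grid_approx:
  assumes r: "r \<ge> 1" and v: "(\<Sum>i<r. (v i)\<^sup>2) \<le> 1"
  shows "\<exists>g\<in>grid r. (\<Sum>i<r. (v i - grid_vec r g i)\<^sup>2) \<le> 1 / 4"
proof -
  have "\<exists>g :: int. \<bar>real_of_int g\<bar> \<le> \<bar>2 * sqrt (real r) * v i\<bar> \<and> \<bar>real_of_int g - 2 * sqrt (real r) * v i\<bar> \<le> 1" for i
    using trunc_toward_zero by metis
  then obtain g0 :: "nat \<Rightarrow> int" where g0: "\<And>i. \<bar>real_of_int (g0 i)\<bar> \<le> \<bar>2 * sqrt (real r) * v i\<bar>"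
    "\<And>i. \<bar>real_of_int (g0 i) - 2 * sqrt (real r) * v i\<bar> \<le> 1" by metis
  define g where "g = (\<lambda>i\<in>{..<r}. g0 i)"
  have sq: "(real_of_int (g0 i))\<^sup>2 \<le> 4 * real r * (v i)\<^sup>2" for i
  proof -
    have "(real_of_int (g0 i))\<^sup>2 \<le> (2 * sqrt (real r) * v i)\<^sup>2" using g0(1)[of i] by (simp add: abs_le_square_iff)
    then show ?thesis by (simp add: power_mult_distrib)
  qed
  have tot: "(\<Sum>i<r. (real_of_int (g0 i))\<^sup>2) \<le> 4 * real r"
  proof -
    have "(\<Sum>i<r. (real_of_int (g0 i))\<^sup>2) \<le> 4 * real r * (\<Sum>i<r. (v i)\<^sup>2)"
      unfolding sum_distrib_left by (intro sum_mono sq)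
    also have "\<dots> \<le> 4 * real r * 1" using v by (intro mult_left_mono) auto
    finally show ?thesis by simp
  qed
  have box: "g0 i \<in> {- 2 * int r..2 * int r}" if "i < r" for i
  proof -
    have "(real_of_int (g0 i))\<^sup>2 \<le> (\<Sum>i<r. (real_of_int (g0 i))\<^sup>2)"
      using that by (intro member_le_sum) auto
    also have "\<dots> \<le> 4 * real r" by (rule tot)
    also have "\<dots> \<le> (2 * real r)\<^sup>2" using r by (simp add: power2_eq_square)
    finally have "\<bar>real_of_int (g0 i)\<bar> \<le> \<bar>2 * real r\<bar>" by (simp only: abs_le_square_iff)
    then have "\<bar>g0 i\<bar> \<le> 2 * int r" by linarith
    then show ?thesis by auto
  qed
  have "g \<in> grid r" using box tot by (auto simp: grid_def g_def)
  moreover have "(\<Sum>i<r. (v i - grid_vec r g i)\<^sup>2) \<le> 1 / 4"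
  proof -
    have "(v i - grid_vec r g i)\<^sup>2 \<le> 1 / (4 * real r)" if "i < r" for i
    proof -
      have "v i - grid_vec r g i = - (real_of_int (g0 i) - 2 * sqrt (real r) * v i) / (2 * sqrt (real r))"
        using that r by (simp add: grid_vec_def g_def field_simps)
      then have "(v i - grid_vec r g i)\<^sup>2 = (real_of_int (g0 i) - 2 * sqrt (real r) * v i)\<^sup>2 / (4 * real r)"
        by (simp only: power_divide power_mult_distrib power2_minus) simp
      also have "\<dots> \<le> 1 / (4 * real r)"
        using g0(2)[of i] by (intro divide_right_mono) (auto simp: abs_square_le_1)
      finally show ?thesis .
    qed
    then have "(\<Sum>i<r. (v i - grid_vec r g i)\<^sup>2) \<le> (\<Sum>i<r. 1 / (4 * real r))"
      by (intro sum_mono) auto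
    then show ?thesis using r by simp
  qed
  ultimately show ?thesis by blast
qed

section \<open>Norm and rank of Gaussian arrays\<close>

text \<open>From \<open>ln x \<le> x\<close> at \<open>x = y\<^sup>2 / (8 * a)\<close>, multiplied
  by \<open>a / 2\<close>.\<close>

lemma abs_powr_le_exp:
  fixes a y :: real
  assumes a: "a \<ge> 2"
  shows "\<bar>y\<bar> powr a \<le> (8 * a) powr (a / 2) * exp (y\<^sup>2 / 16)"
proof (cases "y = 0")
  case True
  then show ?thesis by simp
next
  case False
  let ?x = "y\<^sup>2 / (8 * a)"
  have x: "?x > 0" using False a by simp
  have "?x powr (a / 2) = exp (a / 2 * ln ?x)" using False a by (simp add: powr_def)
  also have "\<dots> \<le> exp (a / 2 * ?x)"
  proof -
    have "ln ?x \<le> ?x" using ln_le_minus_one[OF x] by linarith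
    then have "a / 2 * ln ?x \<le> a / 2 * ?x" using a by (intro mult_left_mono) auto
    then show ?thesis by (simp only: exp_le_cancel_iff)
  qed
  also have "a / 2 * ?x = y\<^sup>2 / 16" using a by (simp add: field_simps)
  finally have "(8 * a) powr (a / 2) * ?x powr (a / 2) \<le> (8 * a) powr (a / 2) * exp (y\<^sup>2 / 16)"
    by (rule mult_left_mono) simp
  moreover have "(8 * a) powr (a / 2) * ?x powr (a / 2) = (y\<^sup>2) powr (a / 2)"
    using a by (simp add: powr_mult[symmetric])
  moreover have "(y\<^sup>2) powr (a / 2) = \<bar>y\<bar> powr a"
  proof -
    have "(y\<^sup>2) powr (a / 2) = (\<bar>y\<bar> powr 2) powr (a / 2)" by simp
    also have "\<dots> = \<bar>y\<bar> powr (2 * (a / 2))" by (rule powr_powr)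
    finally show ?thesis by simp
  qed
  ultimately show ?thesis by simp
qed

text \<open>The summands are the Euclidean cost \<open>8 * sqrt r\<close> of the heavy coordinates
  and the cost \<open>4 * sqrt (8 * a) * n powr (1 / a)\<close> of the light ones in the
  \<open>a\<close>-norm, both doubled because the net has covering radius 1/2.\<close>

definition norm_bound :: "nat \<Rightarrow> nat \<Rightarrow> real \<Rightarrow> real" where
  "norm_bound n r a = 16 * sqrt (real r) + 8 * sqrt (8 * a) * real n powr (1 / a)"

text \<open>Entries of \<open>y\<close> above the threshold are paid for in the Euclidean norm, the others in
  the \<open>a\<close>-norm.\<close>

lemma tame_bilinear_le:
  fixes z :: "nat \<Rightarrow> real"
  assumes r: "1 \<le> r" "r \<le> n" and tame: "tame n r X" and g: "g \<in> grid r"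
    and a: "a \<ge> 2" and b: "b > 1" "1 / a + 1 / b = 1" and q: "0 < q" "q \<le> b" "q \<le> 2"
    and Q: "Q > 0" "(\<Sum>j<n. \<bar>z j\<bar> powr q) \<le> Q powr q"
  shows "(\<Sum>j<n. lin r (grid_vec r g) (X j) * z j) \<le> norm_bound n r a / 2 * Q"
proof -
  let ?y = "\<lambda>j. lin r (grid_vec r g) (X j)"
  let ?\<tau> = "threshold n r"
  define H where "H = {j \<in> {..<n}. (?y j)\<^sup>2 > ?\<tau>}"
  have H: "H \<subseteq> {..<n}" "finite H" by (auto simp: H_def)
  have sub: "(\<Sum>j\<in>J. \<bar>z j\<bar> powr b') \<le> Q powr b'" if "J \<subseteq> {..<n}" "q \<le> b'" for J b'
  proof -
    have "(\<Sum>j\<in>J. \<bar>z j\<bar> powr b') \<le> (\<Sum>j<n. \<bar>z j\<bar> powr b')"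
      using that by (intro sum_mono2) auto
    also have "\<dots> \<le> Q powr b'"
      by (rule sum_powr_mono_exponent[OF _ q(1) that(2) Q]) simp
    finally show ?thesis .
  qed
  have "(\<Sum>j\<in>H. \<bar>?y j * z j\<bar>) \<le> 8 * sqrt (real r) * Q"
  proof (rule Holder_sum_le[of 2 2])
    have "(\<Sum>j\<in>H. \<bar>?y j\<bar> powr 2) = (\<Sum>j\<in>H. heavy ?\<tau> (?y j))"
      by (intro sum.cong) (auto simp: H_def heavy_def)
    also have "\<dots> \<le> (\<Sum>j<n. heavy ?\<tau> (?y j))"
      using H by (intro sum_mono2) (auto simp: heavy_def)
    also have "\<dots> \<le> 64 * real r" using tame g by (force simp: tame_def)
    also have "\<dots> = (8 * sqrt (real r)) powr 2" by (simp add: power_mult_distrib)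
    finally show "(\<Sum>j\<in>H. \<bar>?y j\<bar> powr 2) \<le> (8 * sqrt (real r)) powr 2" .
    show "(\<Sum>j\<in>H. \<bar>z j\<bar> powr 2) \<le> Q powr 2" by (rule sub[OF H(1) q(3)])
  qed (use r Q in auto)
  moreover have "(\<Sum>j\<in>{..<n} - H. \<bar>?y j * z j\<bar>) \<le> (4 * sqrt (8 * a) * real n powr (1 / a)) * Q"
  proof (rule Holder_sum_le[of a b])
    have "(\<Sum>j\<in>{..<n} - H. \<bar>?y j\<bar> powr a) \<le> (\<Sum>j\<in>{..<n} - H. (8 * a) powr (a / 2) * light ?\<tau> (?y j))"
      using abs_powr_le_exp[OF a] by (intro sum_mono) (auto simp: H_def light_def)
    also have "\<dots> \<le> (\<Sum>j<n. (8 * a) powr (a / 2) * light ?\<tau> (?y j))"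
      using H by (intro sum_mono2) (auto simp: light_def)
    also have "\<dots> = (8 * a) powr (a / 2) * (\<Sum>j<n. light ?\<tau> (?y j))"
      by (simp add: sum_distrib_left)
    also have "\<dots> \<le> (8 * a) powr (a / 2) * (16 * real n)"
      using tame g by (intro mult_left_mono) (force simp: tame_def)+
    also have "\<dots> \<le> (8 * a) powr (a / 2) * (4 powr a * real n)"
    proof -
      have "4 powr 2 \<le> (4 :: real) powr a" using a by (intro powr_mono) auto
      then show ?thesis by (intro mult_left_mono mult_right_mono) auto
    qed
    also have "\<dots> = (4 * sqrt (8 * a) * real n powr (1 / a)) powr a"
      using a r by (simp add: powr_mult powr_powr flip: powr_half_sqrt)
    finally show "(\<Sum>j\<in>{..<n} - H. \<bar>?y j\<bar> powr a) \<le> (4 * sqrt (8 * a) * real n powr (1 / a)) powr a" .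
    show "(\<Sum>j\<in>{..<n} - H. \<bar>z j\<bar> powr b) \<le> Q powr b" by (rule sub[OF _ q(2)]) auto
  qed (use a b r Q in auto)
  moreover have "(\<Sum>j<n. ?y j * z j) \<le> (\<Sum>j\<in>H. \<bar>?y j * z j\<bar>) + (\<Sum>j\<in>{..<n} - H. \<bar>?y j * z j\<bar>)"
  proof -
    have "(\<Sum>j<n. ?y j * z j) \<le> (\<Sum>j<n. \<bar>?y j * z j\<bar>)" by (intro sum_mono) auto
    then show ?thesis using sum.subset_diff[OF H(1), of "\<lambda>j. \<bar>?y j * z j\<bar>"] by simp
  qed
  ultimately show ?thesis by (simp add: norm_bound_def algebra_simps)
qed

text \<open>Net argument in the output space: the Euclidean norm \<open>S\<close> of the image is
  its inner product with a unit vector \<open>v\<close>. A grid point within 1/2 of \<open>v\<close>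
  leads to the bilinear bound, and the error, at most \<open>S / 2\<close>, is absorbed on the
  left.\<close>

lemma tame_norm_le:
  fixes z :: "nat \<Rightarrow> real"
  assumes r: "1 \<le> r" "r \<le> n" and tame: "tame n r X"
    and a: "a \<ge> 2" and b: "b > 1" "1 / a + 1 / b = 1" and q: "0 < q" "q \<le> b" "q \<le> 2"
    and Q: "Q > 0" "(\<Sum>j<n. \<bar>z j\<bar> powr q) \<le> Q powr q"
  shows "sqrt (\<Sum>i<r. (\<Sum>j<n. X j i * z j)\<^sup>2) \<le> norm_bound n r a * Q"
proof -
  define w where "w = (\<lambda>i. \<Sum>j<n. X j i * z j)"
  define S where "S = sqrt (\<Sum>i<r. (w i)\<^sup>2)"
  have S2: "(\<Sum>i<r. (w i)\<^sup>2) = S\<^sup>2" by (simp add: S_def sum_nonneg)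
  have nb: "norm_bound n r a \<ge> 0" using a by (simp add: norm_bound_def)
  show ?thesis
  proof (cases "S = 0")
    case True
    then show ?thesis using nb Q by (simp add: S_def w_def)
  next
    case False
    then have S: "S > 0" by (simp add: S_def less_le sum_nonneg)
    define v where "v = (\<lambda>i. w i / S)"
    have v1: "(\<Sum>i<r. (v i)\<^sup>2) = 1"
      using S by (simp add: v_def power_divide sum_divide_distrib[symmetric] S2)
    then obtain g where g: "g \<in> grid r" and d: "(\<Sum>i<r. (v i - grid_vec r g i)\<^sup>2) \<le> 1 / 4"
      using grid_approx[OF r(1), of v] by auto
    have "S = (\<Sum>i<r. v i * w i)"
    proof -
      have "(\<Sum>i<r. v i * w i) = (\<Sum>i<r. (w i)\<^sup>2) / S"
        by (simp add: v_def power2_eq_square sum_divide_distrib)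
      also have "\<dots> = S" unfolding S2 using S by (simp add: power2_eq_square)
      finally show ?thesis by (rule sym)
    qed
    also have "\<dots> = (\<Sum>i<r. grid_vec r g i * w i) + (\<Sum>i<r. (v i - grid_vec r g i) * w i)"
      by (simp add: sum.distrib[symmetric] algebra_simps)
    also have "(\<Sum>i<r. (v i - grid_vec r g i) * w i) \<le> S / 2"
    proof (rule power2_le_imp_le)
      have "(\<Sum>i<r. (v i - grid_vec r g i) * w i)\<^sup>2 \<le>
          (\<Sum>i<r. (v i - grid_vec r g i)\<^sup>2) * (\<Sum>i<r. (w i)\<^sup>2)"
        by (rule Cauchy_Schwarz_ineq_sum)
      also have "\<dots> \<le> 1 / 4 * S\<^sup>2" unfolding S2 using d by (intro mult_right_mono) auto
      finally show "(\<Sum>i<r. (v i - grid_vec r g i) * w i)\<^sup>2 \<le> (S / 2)\<^sup>2" by (simp add: power_divide)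
    qed (use S in simp)
    also have "(\<Sum>i<r. grid_vec r g i * w i) = (\<Sum>j<n. lin r (grid_vec r g) (X j) * z j)"
    proof -
      have "(\<Sum>i<r. grid_vec r g i * w i) = (\<Sum>i<r. \<Sum>j<n. grid_vec r g i * X j i * z j)"
        by (simp add: w_def sum_distrib_left mult.assoc)
      also have "\<dots> = (\<Sum>j<n. \<Sum>i<r. grid_vec r g i * X j i * z j)" by (rule sum.swap)
      finally show ?thesis by (simp add: lin_def sum_distrib_right)
    qed
    also have "\<dots> \<le> norm_bound n r a / 2 * Q"
      by (rule tame_bilinear_le[OF r tame g a b q Q])
    finally have "S \<le> norm_bound n r a / 2 * Q + S / 2" by simp
    then show ?thesis by (simp add: S_def w_def)
  qed
qed

section \<open>Rank of embedded arrays\<close>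

lemma embed_Suc:
  assumes "r < n"
  shows "embed_mat n (Suc r) X = embed_mat n r X + mat n n (\<lambda>(i, j). (if i = r then 1 else 0) * X j r)"
  by (rule eq_matI) (auto simp: embed_mat_def less_Suc_eq)

lemma rank_embed_le: "r \<le> n \<Longrightarrow> vec_space.rank n (embed_mat n r X) \<le> r"
proof (induction r)
  case 0
  interpret vec_space "TYPE(real)" n .
  have "embed_mat n 0 X = 0\<^sub>m n n" by (rule eq_matI) (auto simp: embed_mat_def)
  then show ?case by (simp add: rank_0I)
next
  case (Suc r)
  interpret vec_space "TYPE(real)" n .
  let ?B = "mat n n (\<lambda>(i, j). (if i = r then 1 else 0) * X j r)"
  have "rank (embed_mat n (Suc r) X) \<le> rank (embed_mat n r X) + rank ?B"
    unfolding embed_Suc[OF Suc_le_lessD[OF Suc.prems]]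
    by (rule rank_subadditive[of _ n]) auto
  moreover have "rank ?B \<le> 1"
    by (rule rank_le_1_product_entries[of _ n "\<lambda>i. if i = r then 1 else 0" "\<lambda>j. X j r"]) auto
  ultimately show ?case using Suc by simp
qed

definition block :: "nat \<Rightarrow> (nat \<Rightarrow> nat \<Rightarrow> real) \<Rightarrow> real mat" where
  "block r X = mat r r (\<lambda>(i, j). X j i)"

lemma pick_lessThan: "i < r \<Longrightarrow> pick {..<r} i = i"
proof (induction i)
  case 0
  then show ?case by (simp add: Least_eq_0)
next
  case (Suc i)
  then show ?case by (auto intro!: Least_equality)
qed

text \<open>The nonzero rows bound the rank from above, the leading minor of size \<open>r\<close>
  from below.\<close>

lemma rank_embed:
  assumes r: "r \<le> n" and det: "det (block r X) \<noteq> 0"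
  shows "vec_space.rank n (embed_mat n r X) = r"
proof (rule antisym)
  interpret vec_space "TYPE(real)" n .
  have c: "card {i. i < n \<and> i \<in> {..<r}} = r"
  proof -
    have "{i. i < n \<and> i \<in> {..<r}} = {..<r}" using r by auto
    then show ?thesis by simp
  qed
  have "submatrix (embed_mat n r X) {..<r} {..<r} = block r X"
  proof (rule eq_matI)
    fix i j assume "i < dim_row (block r X)" "j < dim_col (block r X)"
    then have ij: "i < r" "j < r" by (auto simp: block_def)
    then have "submatrix (embed_mat n r X) {..<r} {..<r} $$ (i, j) = embed_mat n r X $$ (i, j)"
      using submatrix_index[of i "embed_mat n r X" "{..<r}" j "{..<r}"] c
      by (simp add: pick_lessThan)
    also have "\<dots> = X j i" using ij r by (simp add: embed_index)
    finally show "submatrix (embed_mat n r X) {..<r} {..<r} $$ (i, j) = block r X $$ (i, j)"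
      using ij by (simp add: block_def)
  qed (use c in \<open>auto simp: dim_submatrix block_def\<close>)
  then have "card {i. i < n \<and> i \<in> {..<r}} \<le> rank (embed_mat n r X)"
    using det by (intro rank_gt_minor[of _ n "{..<r}"]) auto
  then show "r \<le> rank (embed_mat n r X)" by (simp only: c)
qed (rule rank_embed_le[OF r])

text \<open>The Leibniz formula shows a polynomial in the entries of \<open>X\<close>, from which
  measurability is read off.\<close>

lemma det_block: "det (block r X) =
   (\<Sum>p | p permutes {0..<r}. signof p * (\<Prod>i = 0..<r. X (p i) i))"
proof -
  have "det (block r X) = (\<Sum>p | p permutes {0..<r}. signof p * (\<Prod>i = 0..<r. block r X $$ (i, p i)))"
    by (simp add: det_def block_def)
  also have "\<dots> = (\<Sum>p | p permutes {0..<r}. signof p * (\<Prod>i = 0..<r. X (p i) i))"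
    by (intro sum.cong refl arg_cong2[where f = "(*)"] prod.cong)
      (auto simp: block_def dest: permutes_in_image)
  finally show ?thesis .
qed

definition diag_shift :: "real \<Rightarrow> nat \<Rightarrow> nat \<Rightarrow> real" where
  "diag_shift t j i = (if i = j then t else 0)"

text \<open>The shifted block is singular only if \<open>- t\<close> is an eigenvalue of the
  original one, that is, a root of its characteristic polynomial.\<close>

lemma finite_singular_diag_shift:
  assumes "r \<le> n"
  shows "finite {t. det (block r (array_shift n r (diag_shift t) X)) = 0}"
proof -
  have B: "block r X \<in> carrier_mat r r" by (simp add: block_def)
  have "block r (array_shift n r (diag_shift t) X) = char_matrix (block r X) (- t)" for t
    using assms by (intro eq_matI) (auto simp: block_def char_matrix_def array_shift_def diag_shift_def)
  then have "{t. det (block r (array_shift n r (diag_shift t) X)) = 0} \<subseteq> uminus ` {t. poly (char_poly (block r X)) t = 0}"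
    using eigenvalue_det[OF B] eigenvalue_root_char_poly[OF B] by force
  moreover have "char_poly (block r X) \<noteq> 0" using degree_monic_char_poly[OF B] by auto
  then have "finite {t. poly (char_poly (block r X)) t = 0}" by (rule poly_roots_finite)
  ultimately show ?thesis using finite_surj by blast
qed

text \<open>Shifting along the identity meets the singular set in finitely many points, so by Fubini
  some translate of the singular set is null; the Gaussian measure is quasi-invariant.\<close>

lemma AE_det_block_shift:
  assumes "r \<le> n"
  shows "AE X in gmat n r. det (block r (array_shift n r h X)) \<noteq> 0"
proof -
  let ?M = "gmat n r"
  interpret M: prob_space ?M by (rule prob_space_gmat)
  interpret pair_sigma_finite lborel ?M ..
  define Z where "Z = {X \<in> space ?M. det (block r X) = 0}"
  have perm: "p i < n" if "p permutes {0..<r}" "i \<in> {0..<r}" for p i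
    using permutes_in_image[OF that(1), of i] that(2) assms by auto
  have [measurable]: "(\<lambda>X. det (block r X)) \<in> borel_measurable ?M"
    unfolding det_block using perm by (intro borel_measurable_sum borel_measurable_times borel_measurable_prod) auto
  have Z [measurable]: "Z \<in> sets ?M" unfolding Z_def by measurable
  have shift_eq: "det (block r (array_shift n r (diag_shift t) X)) =
      (\<Sum>p | p permutes {0..<r}. signof p * (\<Prod>i = 0..<r. X (p i) i + diag_shift t (p i) i))" for t X
    unfolding det_block using perm
    by (intro sum.cong refl arg_cong2[where f = "(*)"] prod.cong) (auto simp: array_shift_def)
  have meas: "(\<lambda>(t, X). indicator Z (array_shift n r (diag_shift t) X) :: ennreal) \<in> borel_measurable (lborel \<Otimes>\<^sub>M ?M)"
  proof -
    have [measurable]: "(\<lambda>t. diag_shift t j i) \<in> borel_measurable borel" for i j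
      by (simp add: diag_shift_def)
    have "(\<lambda>p. det (block r (array_shift n r (diag_shift (fst p)) (snd p)))) \<in> borel_measurable (lborel \<Otimes>\<^sub>M ?M)"
      unfolding shift_eq using perm
      by (intro borel_measurable_sum borel_measurable_times borel_measurable_prod borel_measurable_add) auto
    then have "{p \<in> space (lborel \<Otimes>\<^sub>M ?M). det (block r (array_shift n r (diag_shift (fst p)) (snd p))) = 0} \<in> sets (lborel \<Otimes>\<^sub>M ?M)"
      by measurable
    then have "(indicator {p \<in> space (lborel \<Otimes>\<^sub>M ?M). det (block r (array_shift n r (diag_shift (fst p)) (snd p))) = 0} :: _ \<Rightarrow> ennreal)
       \<in> borel_measurable (lborel \<Otimes>\<^sub>M ?M)" by measurable
    then show ?thesis
      by (rule measurable_cong[THEN iffD1, rotated])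
         (use measurable_space[OF measurable_shift] in \<open>auto simp: indicator_def Z_def space_pair_measure\<close>)
  qed
  have "(\<integral>\<^sup>+t. (\<integral>\<^sup>+X. indicator Z (array_shift n r (diag_shift t) X) \<partial>?M) \<partial>lborel) =
      (\<integral>\<^sup>+X. (\<integral>\<^sup>+t. indicator Z (array_shift n r (diag_shift t) X) \<partial>lborel) \<partial>?M)"
    using Fubini'[OF meas] by simp
  also have "\<dots> = (\<integral>\<^sup>+X. 0 \<partial>?M)"
  proof (rule nn_integral_cong)
    fix X
    let ?T = "{t. det (block r (array_shift n r (diag_shift t) X)) = 0}"
    have "finite ?T" by (rule finite_singular_diag_shift[OF assms])
    then have "?T \<in> null_sets lborel" by (simp add: finite_imp_null_set_lborel)
    then have "AE t in lborel. t \<notin> ?T" by (rule AE_not_in)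
    then have "AE t in lborel. indicator Z (array_shift n r (diag_shift t) X) = (0 :: ennreal)"
      by eventually_elim (simp add: Z_def)
    then show "(\<integral>\<^sup>+t. indicator Z (array_shift n r (diag_shift t) X) \<partial>lborel) = 0"
      by (subst nn_integral_cong_AE[where v = "\<lambda>_. 0"]) auto
  qed
  finally have "(\<integral>\<^sup>+t. (\<integral>\<^sup>+X. indicator Z (array_shift n r (diag_shift t) X) \<partial>?M) \<partial>lborel) = 0" by simp
  moreover have "(\<lambda>t. \<integral>\<^sup>+X. indicator Z (array_shift n r (diag_shift t) X) \<partial>?M) \<in> borel_measurable lborel"
    using M.borel_measurable_nn_integral_fst[OF meas] by simp
  ultimately have "AE t in lborel. (\<integral>\<^sup>+X. indicator Z (array_shift n r (diag_shift t) X) \<partial>?M) = 0"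
    by (subst (asm) nn_integral_0_iff_AE) auto
  then obtain t where "(\<integral>\<^sup>+X. indicator Z (array_shift n r (diag_shift t) X) \<partial>?M) = 0"
    using eventually_happens'[of "ae_filter lborel"] by (auto simp: ae_filter_eq_bot_iff)
  then have "(\<integral>\<^sup>+X. ennreal (shift_density n r (diag_shift t) X) * indicator Z X \<partial>?M) = 0"
    by (subst (asm) nn_integral_gmat_shift) auto
  then have "AE X in ?M. ennreal (shift_density n r (diag_shift t) X) * indicator Z X = 0"
    by (subst (asm) nn_integral_0_iff_AE) auto
  then have "AE X in ?M. indicator Z X = (0 :: ennreal)"
    by eventually_elim (auto simp: shift_density_def)
  then have "(\<integral>\<^sup>+X. ennreal (shift_density n r h X) * indicator Z X \<partial>?M) = 0"
    by (subst nn_integral_0_iff_AE) (auto elim: eventually_mono)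
  then have "(\<integral>\<^sup>+X. indicator Z (array_shift n r h X) \<partial>?M) = 0"
    by (subst nn_integral_gmat_shift) auto
  then have "AE X in ?M. indicator Z (array_shift n r h X) = (0 :: ennreal)"
    by (subst (asm) nn_integral_0_iff_AE) (auto intro: measurable_compose[OF measurable_shift])
  then show ?thesis
    using measurable_space[OF measurable_shift, of _ n r h]
    by (auto simp: Z_def indicator_def elim!: AE_mp split: if_splits)
qed

section \<open>From sketches to distinguishing Gaussian arrays\<close>

lemma linear_map_embed:
  assumes "r \<le> n"
  shows "linear_map k n c (embed_mat n r X) = (\<lambda>l\<in>{..<k}. dot n r (\<lambda>j i. c (l, i, j)) X)"
proof -
  have "(\<Sum>i<n. \<Sum>j<n. c (l, i, j) * embed_mat n r X $$ (i, j)) = dot n r (\<lambda>j i. c (l, i, j)) X" for l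
  proof -
    have "(\<Sum>i<n. \<Sum>j<n. c (l, i, j) * embed_mat n r X $$ (i, j)) =
        (\<Sum>i<n. if i < r then \<Sum>j<n. c (l, i, j) * X j i else 0)"
      by (intro sum.cong refl) (auto simp: embed_index intro!: sum.neutral)
    also have "\<dots> = (\<Sum>i<r. \<Sum>j<n. c (l, i, j) * X j i)" by (rule sum_lessThan_if_less[OF assms])
    also have "\<dots> = dot n r (\<lambda>j i. c (l, i, j)) X" unfolding dot_def by (rule sum.swap)
    finally show ?thesis .
  qed
  then show ?thesis by (simp add: linear_map_def)
qed

lemma dot_shift: "dot n r v (array_shift n r h X) = dot n r v X + dot n r v h"
proof -
  have "dot n r v (array_shift n r h X) = dot n r v (\<lambda>j i. X j i + h j i)"
    unfolding dot_def by (intro sum.cong refl) (auto simp: array_shift_def)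
  then show ?thesis by (simp add: dot_add_right)
qed

lemma norm_bound_pos: "r \<ge> 1 \<Longrightarrow> a \<ge> 2 \<Longrightarrow> norm_bound n r a > 0"
  unfolding norm_bound_def by (intro add_pos_nonneg) auto

lemma tame_op_norm_le:
  assumes r: "1 \<le> r" "r \<le> n" and tame: "tame n r X" and p: "1 \<le> p" "p \<le> 2"
    and a: "a \<ge> 2" and b: "b > 1" "1 / a + 1 / b = 1" and q: "0 < q" "q \<le> b" "q \<le> 2"
  shows "op_norm q p (embed_mat n r X) \<le> real r powr (1 / p - 1 / 2) * norm_bound n r a"
proof (rule op_norm_embed_le[OF r p q(1)])
  show "norm_bound n r a \<ge> 0" using norm_bound_pos[of r a n] r a by simp
  fix z :: "real vec" assume z: "dim_vec z = n"
  show "sqrt (\<Sum>i<r. (\<Sum>j<n. X j i * z $ j)\<^sup>2) \<le> norm_bound n r a * lp_norm q z"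
  proof (cases "z = 0\<^sub>v (dim_vec z)")
    case True
    then have "z $ j = 0" if "j < n" for j using that z by (metis index_zero_vec(1))
    then have "(\<Sum>i<r. (\<Sum>j<n. X j i * z $ j)\<^sup>2) = 0" by simp
    then show ?thesis using norm_bound_pos[of r a n] r a by simp
  next
    case False
    show ?thesis
      by (rule tame_norm_le[OF r tame a b q lp_norm_pos[OF False]])
         (simp add: lp_norm_powr[OF q(1)] z)
  qed
qed

text \<open>Column \<open>j\<close> of a tame array is the image of a unit vector, so its Euclidean
  norm is at most \<open>?R\<close> and its 1-norm at most \<open>sqrt r * ?R\<close>. The plant has
  1-norm \<open>s * r = (G + 1) * sqrt r * ?R\<close>, so a surplus of
  \<open>G * sqrt r * ?R\<close> survives.\<close>

lemma tame_op_norm_shift_ge: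
  assumes r: "1 \<le> r" "r \<le> n" and tame: "tame n r X" and p: "1 \<le> p"
    and a: "a \<ge> 2" and b: "b > 1" "1 / a + 1 / b = 1" and q: "0 < q" "q \<le> b" "q \<le> 2"
    and u: "u \<in> signs r" and j: "j < n" and s: "s = (G + 1) * norm_bound n r a / sqrt (real r)"
  shows "G * (real r powr (1 / p - 1 / 2) * norm_bound n r a) \<le>
    op_norm q p (embed_mat n r (array_shift n r (plant s u j) X))"
proof -
  let ?R = "norm_bound n r a"
  have col: "(\<Sum>i<r. \<bar>X j i\<bar>) \<le> sqrt (real r) * ?R"
  proof -
    let ?e = "\<lambda>j'. if j' = j then 1 else 0 :: real"
    have e: "(\<Sum>j'<n. X j' i * ?e j') = X j i" for i
    proof -
      have "(\<Sum>j'<n. X j' i * ?e j') = (\<Sum>j'<n. if j' = j then X j i else 0)"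
        by (intro sum.cong) auto
      then show ?thesis using j by simp
    qed
    have "(\<Sum>j'<n. \<bar>?e j'\<bar> powr q) = (\<Sum>j'<n. if j' = j then 1 else 0)"
      using q by (intro sum.cong) auto
    then have "(\<Sum>j'<n. \<bar>?e j'\<bar> powr q) \<le> 1 powr q" using j by simp
    then have "sqrt (\<Sum>i<r. (\<Sum>j'<n. X j' i * ?e j')\<^sup>2) \<le> ?R * 1"
      by (intro tame_norm_le[OF r tame a b q]) auto
    then have "sqrt (\<Sum>i<r. (X j i)\<^sup>2) \<le> ?R" unfolding e by simp
    moreover have "(\<Sum>i<r. \<bar>X j i\<bar>) \<le> sqrt (real r * (\<Sum>i<r. (X j i)\<^sup>2))"
    proof (rule real_le_rsqrt)
      show "(\<Sum>i<r. \<bar>X j i\<bar>)\<^sup>2 \<le> real r * (\<Sum>i<r. (X j i)\<^sup>2)"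
        using Cauchy_Schwarz_ineq_sum[of "\<lambda>_. 1" "\<lambda>i. \<bar>X j i\<bar>" "{..<r}"] by simp
    qed
    ultimately show ?thesis
      by (simp add: real_sqrt_mult) (meson mult_left_mono order_trans real_sqrt_ge_zero of_nat_0_le_iff)
  qed
  have R: "?R > 0" using norm_bound_pos[of r a n] r a by simp
  have sr: "s * real r = (G + 1) * ?R * sqrt (real r)"
  proof -
    have "real r = sqrt (real r) * sqrt (real r)" by simp
    then have "s * real r = s * sqrt (real r) * sqrt (real r)" by (metis mult.assoc)
    also have "s * sqrt (real r) = (G + 1) * ?R" using r by (simp add: s)
    finally show ?thesis .
  qed
  have "s * real r - (\<Sum>i<r. \<bar>X j i\<bar>) = (\<Sum>i<r. s - \<bar>X j i\<bar>)" by (simp add: sum_subtractf)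
  also have "\<dots> \<le> (\<Sum>i<r. \<bar>array_shift n r (plant s u j) X j i\<bar>)"
  proof (rule sum_mono)
    fix i assume i: "i \<in> {..<r}"
    have "\<bar>u i\<bar> = 1" using signs_square[OF u, of i] i by (simp add: abs_square_eq_1)
    then have "\<bar>s * u i\<bar> = \<bar>s\<bar>" by (simp add: abs_mult)
    then show "s - \<bar>X j i\<bar> \<le> \<bar>array_shift n r (plant s u j) X j i\<bar>"
      using i j by (simp add: array_shift_def plant_def)
  qed
  finally have "G * ?R * sqrt (real r) \<le> (\<Sum>i<r. \<bar>array_shift n r (plant s u j) X j i\<bar>)"
    using col sr by (simp add: algebra_simps)
  then have "real r powr (1 / p - 1) * (G * ?R * sqrt (real r)) \<le>
      real r powr (1 / p - 1) * (\<Sum>i<r. \<bar>array_shift n r (plant s u j) X j i\<bar>)"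
    by (intro mult_left_mono) auto
  also have "\<dots> \<le> op_norm q p (embed_mat n r (array_shift n r (plant s u j) X))"
    by (rule op_norm_embed_ge[OF r p q(1) j])
  also have "real r powr (1 / p - 1) * (G * ?R * sqrt (real r)) = G * (real r powr (1 / p - 1 / 2) * ?R)"
  proof -
    have "real r powr (1 / p - 1) * sqrt (real r) = real r powr (1 / p - 1 / 2)"
      by (simp add: powr_half_sqrt[symmetric] powr_add[symmetric])
    then show ?thesis by (simp add: mult_ac)
  qed
  finally show ?thesis .
qed

text \<open>Fubini moves the comparison from the random sketch to one coefficient vector: the
  advantage of the test, averaged over sketches, signs and columns, is at least 1/2, so some fixed
  \<open>c\<close> attains it and falls under \<open>sketch_dimension_ge\<close>.\<close>

lemma sketching_family_bound:
  fixes \<gamma> p q a b s \<theta> :: real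
  assumes sk: "sketching_family k \<gamma> q p n (rank_matrices n r) S f" and \<gamma>: "\<gamma> > 1"
    and r: "1 \<le> r" "r \<le> n" and p: "1 \<le> p" "p \<le> 2"
    and a: "a \<ge> 2" and b: "b > 1" "1 / a + 1 / b = 1" and q: "0 < q" "q \<le> b" "q \<le> 2"
    and s: "s = (\<gamma>\<^sup>2 + 1) * norm_bound n r a / sqrt (real r)" and \<theta>: "\<theta> > 0"
    and regime: "\<theta> = 1 / 32 \<or> exp \<theta> * sqrt (real n * (s\<^sup>2 * real r * \<theta>)) \<le> real n / 16"
  shows "real n * \<theta> \<le> 4 * s\<^sup>2 * real k"
proof -
  let ?M = "gmat n r"
  let ?lm = "\<lambda>c X. linear_map k n c (embed_mat n r X)"
  let ?op = "\<lambda>X. op_norm q p (embed_mat n r X)"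
  define T where "T = real r powr (1 / p - 1 / 2) * norm_bound n r a"
  have T: "T > 0" using norm_bound_pos[of r a n] r a by (simp add: T_def)
  from sk have prob_S: "prob_space S" and sets_S: "sets S = sets (euclid_borel (coeff_indices k n))"
    and f: "f \<in> borel_measurable (euclid_borel {..<k})"
    and succ: "\<And>A. A \<in> rank_matrices n r \<Longrightarrow> 5 / 6 \<le> measure S {c \<in> space S. f (linear_map k n c A) \<in>
                  {1 / \<gamma> * op_norm q p A <..< \<gamma> * op_norm q p A}}"
    by (auto simp: sketching_family_def)
  interpret S: prob_space S by (rule prob_S)
  interpret M: prob_space ?M by (rule prob_space_gmat)
  interpret pair_sigma_finite S ?M ..
  interpret SM: pair_prob_space S ?M ..
  have coeff [measurable]: "(\<lambda>c. c (l, i, j)) \<in> borel_measurable S" if "l < k" "i < n" "j < n" for l i j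
  proof -
    have "(\<lambda>c. c (l, i, j)) \<in> borel_measurable (euclid_borel (coeff_indices k n))"
      using that by (intro measurable_component_singleton) (auto simp: coeff_indices_def)
    then show ?thesis by (simp add: measurable_cong_sets[OF sets_S refl])
  qed
  have lm: "(\<lambda>x. ?lm (fst x) (snd x)) \<in> S \<Otimes>\<^sub>M ?M \<rightarrow>\<^sub>M euclid_borel {..<k}"
    unfolding linear_map_embed[OF r(2)] dot_def using r(2)
    by (intro measurable_restrict borel_measurable_sum borel_measurable_times) auto
  \<comment> \<open>The test asks whether the answer lies below \<open>\<gamma> * T\<close>. A
    successful sketch says yes if the norm is at most \<open>T\<close> and no if it is at least
    \<open>\<gamma>\<^sup>2 * T\<close>.\<close>
  define F where "F = (\<lambda>c X. indicator {y. y < \<gamma> * T} (f (?lm c X)) :: real)"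
  have F01: "0 \<le> F c X" "F c X \<le> 1" for c X by (auto simp: F_def indicator_def)
  have F_meas [measurable]: "(\<lambda>x. F (fst x) (snd x)) \<in> borel_measurable (S \<Otimes>\<^sub>M ?M)"
    unfolding F_def by (intro measurable_compose[OF measurable_compose[OF lm f]]) measurable
  have F_shift_meas [measurable]: "(\<lambda>x. F (fst x) (array_shift n r h (snd x))) \<in> borel_measurable (S \<Otimes>\<^sub>M ?M)" for h
  proof -
    have "(\<lambda>x. (fst x, array_shift n r h (snd x))) \<in> S \<Otimes>\<^sub>M ?M \<rightarrow>\<^sub>M S \<Otimes>\<^sub>M ?M" by measurable
    from measurable_compose[OF this F_meas] show ?thesis by simp
  qed
  have F_meas_X [measurable]: "F c \<in> borel_measurable ?M" if "c \<in> space S" for c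
  proof -
    have "(\<lambda>X. (c, X)) \<in> ?M \<rightarrow>\<^sub>M S \<Otimes>\<^sub>M ?M" using that by measurable
    from measurable_compose[OF this F_meas] show ?thesis by simp
  qed
  have swap: "(\<integral>c. (\<integral>X. g c X \<partial>?M) \<partial>S) = (\<integral>X. (\<integral>c. g c X \<partial>S) \<partial>?M)"
    and swap_int: "integrable S (\<lambda>c. \<integral>X. g c X \<partial>?M)" "integrable ?M (\<lambda>X. \<integral>c. g c X \<partial>S)"
    if g: "(\<lambda>x. g (fst x) (snd x)) \<in> borel_measurable (S \<Otimes>\<^sub>M ?M)" "\<And>c X. 0 \<le> g c X" "\<And>c X. g c X \<le> 1"
    for g :: "_ \<Rightarrow> _ \<Rightarrow> real"
  proof -
    have int: "integrable (S \<Otimes>\<^sub>M ?M) (case_prod g)"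
      using g by (intro SM.integrable_const_bound[of _ 1]) (auto simp: case_prod_unfold)
    show "(\<integral>c. (\<integral>X. g c X \<partial>?M) \<partial>S) = (\<integral>X. (\<integral>c. g c X \<partial>S) \<partial>?M)"
      by (rule Fubini_integral[OF int, symmetric])
    show "integrable S (\<lambda>c. \<integral>X. g c X \<partial>?M)" by (rule integrable_fst[OF int])
    show "integrable ?M (\<lambda>X. \<integral>c. g c X \<partial>S)" by (rule integrable_snd[OF int])
  qed
  have F_int: "(\<integral>c. F c X \<partial>S) = measure S {c \<in> space S. f (?lm c X) < \<gamma> * T}" if "X \<in> space ?M" for X
  proof -
    have "(\<integral>c. F c X \<partial>S) = (\<integral>c. indicator {c \<in> space S. f (?lm c X) < \<gamma> * T} c \<partial>S)"
      by (intro Bochner_Integration.integral_cong) (auto simp: F_def indicator_def)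
    also have "\<dots> = measure S ({c \<in> space S. f (?lm c X) < \<gamma> * T} \<inter> space S)" by simp
    also have "{c \<in> space S. f (?lm c X) < \<gamma> * T} \<inter> space S = {c \<in> space S. f (?lm c X) < \<gamma> * T}" by auto
    finally show ?thesis .
  qed
  have lm_c: "(\<lambda>c. f (?lm c X)) \<in> borel_measurable S" if "X \<in> space ?M" for X
  proof -
    have "(\<lambda>c. (c, X)) \<in> S \<rightarrow>\<^sub>M S \<Otimes>\<^sub>M ?M" using that by measurable
    from measurable_compose[OF this measurable_compose[OF lm f]] show ?thesis by simp
  qed
  have rank: "embed_mat n r X \<in> rank_matrices n r" if "det (block r X) \<noteq> 0" for X
    using rank_embed[OF r(2) that] by (simp add: rank_matrices_def)
  have low: "5 / 6 \<le> (\<integral>c. F c X \<partial>S)" if X: "X \<in> space ?M" "det (block r X) \<noteq> 0" "?op X \<le> T" for X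
  proof -
    have [measurable]: "(\<lambda>c. f (?lm c X)) \<in> borel_measurable S" by (rule lm_c[OF X(1)])
    have "\<gamma> * ?op X \<le> \<gamma> * T" using \<gamma> X(3) by (intro mult_left_mono) auto
    then have "{c \<in> space S. f (?lm c X) \<in> {1 / \<gamma> * ?op X <..< \<gamma> * ?op X}} \<subseteq> {c \<in> space S. f (?lm c X) < \<gamma> * T}"
      by auto
    then have "measure S {c \<in> space S. f (?lm c X) \<in> {1 / \<gamma> * ?op X <..< \<gamma> * ?op X}} \<le>
        measure S {c \<in> space S. f (?lm c X) < \<gamma> * T}"
      by (intro S.finite_measure_mono) measurable
    then show ?thesis using succ[OF rank[OF X(2)]] F_int[OF X(1)] by linarith
  qed
  have high: "(\<integral>c. F c X \<partial>S) \<le> 1 / 6" if X: "X \<in> space ?M" "det (block r X) \<noteq> 0" "\<gamma>\<^sup>2 * T \<le> ?op X" for X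
  proof -
    have [measurable]: "(\<lambda>c. f (?lm c X)) \<in> borel_measurable S" by (rule lm_c[OF X(1)])
    let ?E = "{c \<in> space S. f (?lm c X) \<in> {1 / \<gamma> * ?op X <..< \<gamma> * ?op X}}"
    have "1 / \<gamma> * (\<gamma>\<^sup>2 * T) \<le> 1 / \<gamma> * ?op X" using \<gamma> X(3) by (intro mult_left_mono) auto
    moreover have "1 / \<gamma> * (\<gamma>\<^sup>2 * T) = \<gamma> * T" using \<gamma> by (simp add: power2_eq_square)
    ultimately have "{c \<in> space S. f (?lm c X) < \<gamma> * T} \<subseteq> space S - ?E" by auto
    then have "measure S {c \<in> space S. f (?lm c X) < \<gamma> * T} \<le> measure S (space S - ?E)"
      by (intro S.finite_measure_mono) measurable
    also have "\<dots> = 1 - measure S ?E" by (intro S.prob_compl) measurable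
    finally show ?thesis using succ[OF rank[OF X(2)]] F_int[OF X(1)] by linarith
  qed
  have tame_prob: "measure ?M {X \<in> space ?M. \<not> tame n r X} \<le> 1 / 12" by (rule prob_not_tame[OF r])
  have int_not_tame: "(\<integral>X. indicator {X. \<not> tame n r X} X \<partial>?M) \<le> (1 / 12 :: real)"
  proof -
    have "(\<integral>X. indicator {X. \<not> tame n r X} X \<partial>?M) = (\<integral>X. indicator {X \<in> space ?M. \<not> tame n r X} X \<partial>?M :: real)"
      by (intro Bochner_Integration.integral_cong) (auto simp: indicator_def)
    then show ?thesis using tame_prob by simp
  qed
  have ind_int: "integrable ?M (\<lambda>X. indicator {X. \<not> tame n r X} X :: real)"
  proof -
    have "(\<lambda>X. indicator {X. \<not> tame n r X} X :: real) \<in> borel_measurable ?M"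
      by (rule borel_measurable_indicator') measurable
    then show ?thesis by (intro M.integrable_const_bound[of _ 1]) auto
  qed
  \<comment> \<open>The zero shift changes nothing on the index range, so the case without a plant
    follows from the lemma for translates.\<close>
  have "AE X in ?M. det (block r (array_shift n r (\<lambda>_ _. 0) X)) \<noteq> 0" by (rule AE_det_block_shift[OF r(2)])
  then have det0: "AE X in ?M. det (block r X) \<noteq> 0"
  proof (rule AE_mp, intro AE_I2 impI)
    fix X assume "det (block r (array_shift n r (\<lambda>_ _. 0) X)) \<noteq> 0"
    moreover have "block r (array_shift n r (\<lambda>_ _. 0) X) = block r X"
      using r(2) by (intro eq_matI) (auto simp: block_def array_shift_def)
    ultimately show "det (block r X) \<noteq> 0" by simp
  qed
  \<comment> \<open>The value is 5/6 times 11/12: arrays that are not tame count as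
    failures.\<close>
  have base: "55 / 72 \<le> (\<integral>X. (\<integral>c. F c X \<partial>S) \<partial>?M)"
  proof -
    have "55 / 72 \<le> (\<integral>X. 5 / 6 * (1 - indicator {X. \<not> tame n r X} X) \<partial>?M :: real)"
      using int_not_tame ind_int by (simp add: M.prob_space)
    also have "\<dots> \<le> (\<integral>X. (\<integral>c. F c X \<partial>S) \<partial>?M)"
    proof (rule integral_mono_AE)
      show "integrable ?M (\<lambda>X. 5 / 6 * (1 - indicator {X. \<not> tame n r X} X) :: real)"
        using ind_int by (intro integrable_mult_right Bochner_Integration.integrable_diff) auto
      show "integrable ?M (\<lambda>X. \<integral>c. F c X \<partial>S)" by (rule swap_int(2)[OF F_meas F01])
      show "AE X in ?M. 5 / 6 * (1 - indicator {X. \<not> tame n r X} X) \<le> (\<integral>c. F c X \<partial>S)"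
        using det0
      proof (rule AE_mp, intro AE_I2 impI)
        fix X assume X: "X \<in> space ?M" "det (block r X) \<noteq> 0"
        show "5 / 6 * (1 - indicator {X. \<not> tame n r X} X) \<le> (\<integral>c. F c X \<partial>S)"
        proof (cases "tame n r X")
          case True
          have "?op X \<le> T" unfolding T_def by (rule tame_op_norm_le[OF r True p a b q])
          then show ?thesis using low[OF X] True by simp
        next
          case False
          then show ?thesis using F01 by (simp add: integral_nonneg_AE)
        qed
      qed
    qed
    finally show ?thesis .
  qed
  have planted: "(\<integral>X. (\<integral>c. F c (array_shift n r (plant s u j) X) \<partial>S) \<partial>?M) \<le> 1 / 4"
    if u: "u \<in> signs r" and j: "j < n" for u j
  proof -
    let ?h = "plant s u j"
    have "(\<integral>X. (\<integral>c. F c (array_shift n r ?h X) \<partial>S) \<partial>?M) \<le> (\<integral>X. 1 / 6 + indicator {X. \<not> tame n r X} X \<partial>?M)"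
    proof (rule integral_mono_AE)
      show "integrable ?M (\<lambda>X. 1 / 6 + indicator {X. \<not> tame n r X} X :: real)"
        using ind_int by (intro Bochner_Integration.integrable_add) auto
      show "integrable ?M (\<lambda>X. \<integral>c. F c (array_shift n r ?h X) \<partial>S)"
        by (rule swap_int(2)[OF F_shift_meas F01])
      show "AE X in ?M. (\<integral>c. F c (array_shift n r ?h X) \<partial>S) \<le> 1 / 6 + indicator {X. \<not> tame n r X} X"
        using AE_det_block_shift[OF r(2), of ?h]
      proof (rule AE_mp, intro AE_I2 impI)
        fix X assume X: "X \<in> space ?M" "det (block r (array_shift n r ?h X)) \<noteq> 0"
        have sp: "array_shift n r ?h X \<in> space ?M" by (rule measurable_space[OF measurable_shift X(1)])
        show "(\<integral>c. F c (array_shift n r ?h X) \<partial>S) \<le> 1 / 6 + indicator {X. \<not> tame n r X} X"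
        proof (cases "tame n r X")
          case True
          have "\<gamma>\<^sup>2 * T \<le> ?op (array_shift n r ?h X)"
            unfolding T_def by (rule tame_op_norm_shift_ge[OF r True p(1) a b q u j s])
          then show ?thesis using high[OF sp X(2)] True by simp
        next
          case False
          have "(\<integral>c. F c (array_shift n r ?h X) \<partial>S) \<le> 1"
            unfolding F_int[OF sp] by (rule S.prob_le_1)
          then show ?thesis using False by simp
        qed
      qed
    qed
    also have "\<dots> \<le> 1 / 4" using int_not_tame ind_int by (simp add: M.prob_space)
    finally show ?thesis .
  qed
  define D where "D = (\<lambda>c. \<Sum>u\<in>signs r. \<Sum>j<n.
      (\<integral>X. F c X \<partial>?M) - (\<integral>X. F c (array_shift n r (plant s u j) X) \<partial>?M))"
  have intF: "integrable S (\<lambda>c. \<integral>X. F c X \<partial>?M)" by (rule swap_int(1)[OF F_meas F01])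
  have intFh: "integrable S (\<lambda>c. \<integral>X. F c (array_shift n r h X) \<partial>?M)" for h
    by (rule swap_int(1)[OF F_shift_meas F01])
  have intD: "integrable S D"
    unfolding D_def by (intro Bochner_Integration.integrable_sum Bochner_Integration.integrable_diff intF intFh)
  have "2 ^ r * real n / 2 \<le> integral\<^sup>L S D"
  proof -
    have "integral\<^sup>L S D = (\<Sum>u\<in>signs r. \<Sum>j<n. (\<integral>c. (\<integral>X. F c X \<partial>?M) \<partial>S) -
        (\<integral>c. (\<integral>X. F c (array_shift n r (plant s u j) X) \<partial>?M) \<partial>S))"
      unfolding D_def
      by (simp only: Bochner_Integration.integral_sum Bochner_Integration.integrable_sum
          Bochner_Integration.integrable_diff Bochner_Integration.integral_diff intF intFh)
    also have "\<dots> = (\<Sum>u\<in>signs r. \<Sum>j<n. (\<integral>X. (\<integral>c. F c X \<partial>S) \<partial>?M) -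
        (\<integral>X. (\<integral>c. F c (array_shift n r (plant s u j) X) \<partial>S) \<partial>?M))"
      by (simp only: swap[OF F_meas F01] swap[OF F_shift_meas F01])
    \<comment> \<open>The gap \<open>55 / 72 - 1 / 4 = 37 / 72\<close> is just above 1/2, which is
      why 1/12 is small enough in \<open>prob_not_tame\<close>.\<close>
    also have "(\<Sum>u\<in>signs r. \<Sum>j<n. 1 / 2) \<le> \<dots>"
    proof (intro sum_mono)
      fix u j assume "u \<in> signs r" "j \<in> {..<n}"
      then show "1 / 2 \<le> (\<integral>X. (\<integral>c. F c X \<partial>S) \<partial>?M) - (\<integral>X. (\<integral>c. F c (array_shift n r (plant s u j) X) \<partial>S) \<partial>?M)"
        using base planted[of u j] by simp
    qed
    finally show ?thesis by simp
  qed
  then obtain c where c: "c \<in> space S" "2 ^ r * real n / 2 \<le> D c"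
    using S.expectation_less[OF intD, of "2 ^ r * real n / 2"] by (meson AE_I2 not_le)
  have inv: "F c (array_shift n r g X) = F c (array_shift n r h X)"
    if "\<And>l. l < k \<Longrightarrow> dot n r (\<lambda>j i. c (l, i, j)) g = dot n r (\<lambda>j i. c (l, i, j)) h" for g h X
  proof -
    have "?lm c (array_shift n r g X) = ?lm c (array_shift n r h X)"
      unfolding linear_map_embed[OF r(2)] using that by (auto simp: dot_shift)
    then show ?thesis by (simp add: F_def)
  qed
  show ?thesis
    by (rule sketch_dimension_ge[where F = "F c" and v = "\<lambda>l j i. c (l, i, j)", OF F_meas_X[OF c(1)] F01 _ \<theta> inv regime])
       (use r c(2) in \<open>auto simp: D_def\<close>)
qed

section \<open>Choice of the exponent and of the energy threshold\<close>

text \<open>The left side grows like \<open>n powr (1 / 16 + 1 / 2 + 1 / 5)\<close> times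
  \<open>ln n\<close>, and this exponent is below 1. The factor with 1536 is the bound on the
  squared \<open>norm_bound\<close> in the case that needs
  \<open>\<theta> = ln n / 16\<close>.\<close>

lemma large_dimension_regime:
  fixes G :: real
  assumes "G > 0"
  shows "\<exists>N\<ge>1. \<forall>n::nat. real n \<ge> N \<longrightarrow>
    exp (ln (real n) / 16) * sqrt (real n * (G * (1536 * ln (real n) * real n powr (2 / 5)) * (ln (real n) / 16))) \<le> real n / 16"
proof -
  have "eventually (\<lambda>x::real. exp (ln x / 16) * sqrt (x * (G * (1536 * ln x * x powr (2 / 5)) * (ln x / 16))) \<le> x / 16) at_top"
    using assms by real_asymp
  then obtain N where N: "\<And>x. x \<ge> N \<Longrightarrow> exp (ln x / 16) * sqrt (x * (G * (1536 * ln x * x powr (2 / 5)) * (ln x / 16))) \<le> x / 16"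
    by (auto simp: eventually_at_top_linorder)
  then show ?thesis by (intro exI[of _ "max 1 N"]) auto
qed

text \<open>\<open>1 / a\<close> is \<open>\<kappa>\<close> raised to at least \<open>1 / m\<close>,
  which keeps \<open>a\<close> finite when \<open>\<kappa> = 0\<close>, that is,
  \<open>q = 1\<close>. The raise costs a factor of at most \<open>exp 1\<close>, as
  \<open>ln n \<le> m\<close>. The condition \<open>\<kappa> \<le> 1 / a\<close> says that the
  conjugate exponent of \<open>a\<close> is at least \<open>q\<close>.\<close>

lemma exponent_choice:
  fixes \<kappa> :: real
  assumes \<kappa>: "0 \<le> \<kappa>" "\<kappa> \<le> 1 / 2" and n: "n \<ge> 1"
  obtains a where "a \<ge> 2" "\<kappa> \<le> 1 / a" "a \<le> max 2 (ln (real n))" "real n powr (1 / a) \<le> 3 * real n powr \<kappa>"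
proof
  define m where "m = max 2 (ln (real n))"
  define \<alpha> where "\<alpha> = max \<kappa> (1 / m)"
  have m: "m \<ge> 2" "ln (real n) \<le> m" by (auto simp: m_def)
  have "1 / m \<le> 1 / 2" using m by (intro divide_left_mono) auto
  then have \<alpha>: "0 < \<alpha>" "\<alpha> \<le> 1 / 2"
    unfolding \<alpha>_def using \<kappa>(2) m by (auto simp only: less_max_iff_disj intro!: max.boundedI) simp
  show "1 / \<alpha> \<ge> 2" using \<alpha> by (simp add: field_simps)
  show "\<kappa> \<le> 1 / (1 / \<alpha>)" by (simp add: \<alpha>_def)
  have "1 / m \<le> \<alpha>" by (simp add: \<alpha>_def)
  then show "1 / \<alpha> \<le> max 2 (ln (real n))" using m \<alpha> by (simp add: m_def[symmetric] field_simps)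
  have ge1: "1 \<le> real n powr \<kappa>" using n \<kappa> by (simp add: ge_one_powr_ge_zero)
  show "real n powr (1 / (1 / \<alpha>)) \<le> 3 * real n powr \<kappa>"
  proof (cases "\<alpha> = \<kappa>")
    case True
    then show ?thesis by simp
  next
    case False
    then have "\<alpha> = 1 / m" by (auto simp: \<alpha>_def max_def split: if_splits)
    then have "\<alpha> * ln (real n) \<le> 1" using m by (simp add: divide_le_eq)
    then have "real n powr \<alpha> \<le> exp 1" using n by (simp add: powr_def)
    also have "\<dots> \<le> 3" by (rule exp_le)
    also have "\<dots> \<le> 3 * real n powr \<kappa>" using ge1 by simp
    finally show ?thesis by simp
  qed
qed

lemma norm_bound_square_le:
  assumes "a \<ge> 2"
  shows "(norm_bound n r a)\<^sup>2 \<le> 512 * real r + 1024 * a * (real n powr (1 / a))\<^sup>2"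
proof -
  have *: "(x + y)\<^sup>2 \<le> 2 * x\<^sup>2 + 2 * y\<^sup>2" for x y :: real
    using sum_squares_bound[of x y] by (simp add: power2_sum)
  have "(norm_bound n r a)\<^sup>2 \<le> 2 * (16 * sqrt (real r))\<^sup>2 + 2 * (8 * sqrt (8 * a) * real n powr (1 / a))\<^sup>2"
    unfolding norm_bound_def by (rule *)
  also have "\<dots> = 512 * real r + 1024 * a * (real n powr (1 / a))\<^sup>2"
    using assms by (simp add: power_mult_distrib del: powr_power)
  finally show ?thesis .
qed

text \<open>An extended real \<open>q'\<close> covers \<open>q = 1\<close>, where \<open>q'\<close>
  is infinite and the exponent is 0. Finiteness of \<open>1 / q'\<close> comes first, to allow real
  arithmetic.\<close>

lemma conjugate_exponent:
  fixes q :: real and q' :: ennreal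
  assumes q: "q \<in> {1..2}" and conj: "1 / ennreal q + 1 / q' = 1"
  shows "enn2real (1 / q') = 1 - 1 / q"
proof -
  have e: "1 / ennreal q = ennreal (1 / q)"
    using q divide_ennreal[of 1 q] by simp
  have "1 / q' \<le> 1 / ennreal q + 1 / q'" by simp
  then have "1 / q' \<le> 1" by (simp only: conj)
  then obtain b where b: "1 / q' = ennreal b" "b \<ge> 0"
    by (cases "1 / q'") (auto simp: top_unique)
  have "ennreal (1 / q + b) = 1" using conj e b q by (simp add: ennreal_plus)
  then have "1 / q + b = 1" using b q by (simp add: ennreal_eq_1)
  then show ?thesis using b by simp
qed

text \<open>The threshold 1/32 suffices when the factor \<open>a\<close> in \<open>R\<^sup>2\<close>
  is harmless, because \<open>a\<close> is bounded or \<open>r\<close> dominates. Otherwise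
  \<open>\<theta> = ln n / 16\<close> is used, whose logarithm cancels
  \<open>a \<le> ln n\<close>.\<close>

lemma sketching_lower_bound:
  fixes \<gamma> N p q \<kappa> d :: real
  assumes \<gamma>: "\<gamma> > 1" and N1: "N \<ge> 1"
    and N: "\<And>n::nat. real n \<ge> N \<Longrightarrow> exp (ln (real n) / 16) *
      sqrt (real n * ((\<gamma>\<^sup>2 + 1)\<^sup>2 * (1536 * ln (real n) * real n powr (2 / 5)) * (ln (real n) / 16))) \<le> real n / 16"
    and p: "p \<in> {1..2}" and q: "q \<in> {1..2}" and \<kappa>: "\<kappa> = 1 - 1 / q" and r: "1 \<le> r" "r \<le> n"
    and sk: "sketching_family k \<gamma> q p n (rank_matrices n r) S f"
    and d: "d = max (sqrt (real r)) (real n powr \<kappa>)"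
  shows "real n * real r \<le> 6225920 * (\<gamma>\<^sup>2 + 1)\<^sup>2 * N * d\<^sup>2 * real k"
proof -
  define G where "G = (\<gamma>\<^sup>2 + 1)\<^sup>2"
  have G: "G > 0" unfolding G_def by (intro zero_less_power add_nonneg_pos) auto
  have \<kappa>01: "0 \<le> \<kappa>" "\<kappa> \<le> 1 / 2" using q by (auto simp: \<kappa> field_simps)
  obtain a where a: "a \<ge> 2" "\<kappa> \<le> 1 / a" "a \<le> max 2 (ln (real n))" "real n powr (1 / a) \<le> 3 * real n powr \<kappa>"
    using exponent_choice[OF \<kappa>01, of n] r by auto
  define b where "b = 1 / (1 - 1 / a)"
  have a1: "1 / a \<le> 1 / 2" "1 / a > 0" using a(1) by (auto simp: field_simps)
  have b: "b > 1" "1 / a + 1 / b = 1" using a1 by (auto simp: b_def field_simps)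
  have "1 / b \<le> 1 / q" using a(2) b(2) by (simp add: \<kappa>)
  then have qb: "0 < q" "q \<le> b" "q \<le> 2" using q b(1) by (auto simp: field_simps)
  define R where "R = norm_bound n r a"
  define s where "s = (\<gamma>\<^sup>2 + 1) * R / sqrt (real r)"
  have sr: "s\<^sup>2 * real r = G * R\<^sup>2"
    using r by (simp add: s_def G_def power_divide power_mult_distrib)
  have bound: "real n * real r * \<theta> \<le> 4 * G * R\<^sup>2 * real k"
    if \<theta>: "\<theta> > 0" and regime: "\<theta> = 1 / 32 \<or> exp \<theta> * sqrt (real n * (G * R\<^sup>2 * \<theta>)) \<le> real n / 16" for \<theta>
  proof -
    have "real n * \<theta> \<le> 4 * s\<^sup>2 * real k"
      using p by (intro sketching_family_bound[OF sk \<gamma> r _ _ a(1) b qb _ \<theta>])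
        (use regime in \<open>auto simp: s_def R_def sr[unfolded s_def R_def]\<close>)
    then have "real n * \<theta> * real r \<le> 4 * s\<^sup>2 * real k * real r" by (intro mult_right_mono) auto
    also have "\<dots> = 4 * (s\<^sup>2 * real r) * real k" by simp
    finally show ?thesis unfolding sr by (simp add: mult_ac)
  qed
  have small: "real n * real r \<le> 128 * G * R\<^sup>2 * real k"
    using bound[of "1 / 32"] by simp
  have rD: "real r \<le> d\<^sup>2"
  proof -
    have "(sqrt (real r))\<^sup>2 \<le> d\<^sup>2" unfolding d by (intro power_mono) auto
    then show ?thesis by simp
  qed
  have nD: "(real n powr \<kappa>)\<^sup>2 \<le> d\<^sup>2" unfolding d by (intro power_mono) auto
  have na: "(real n powr (1 / a))\<^sup>2 \<le> 9 * (real n powr \<kappa>)\<^sup>2"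
    using power_mono[OF a(4), of 2] by (simp add: power_mult_distrib del: powr_power)
  have R2: "R\<^sup>2 \<le> 512 * real r + 9216 * (a * (real n powr \<kappa>)\<^sup>2)"
  proof -
    have "R\<^sup>2 \<le> 512 * real r + 1024 * a * (real n powr (1 / a))\<^sup>2"
      unfolding R_def by (rule norm_bound_square_le[OF a(1)])
    also have "\<dots> \<le> 512 * real r + 1024 * a * (9 * (real n powr \<kappa>)\<^sup>2)"
      using a(1) na by (intro add_left_mono mult_left_mono) auto
    finally show ?thesis by simp
  qed
  have R2a: "R\<^sup>2 \<le> 9728 * a * d\<^sup>2"
  proof -
    have "1 * d\<^sup>2 \<le> a * d\<^sup>2" using a(1) by (intro mult_right_mono) auto
    moreover have "a * (real n powr \<kappa>)\<^sup>2 \<le> a * d\<^sup>2" using a(1) nD by (intro mult_left_mono) auto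
    ultimately show ?thesis using R2 rD by linarith
  qed
  \<comment> \<open>The constant 48640 is \<open>5 * 9728\<close>, from \<open>R2a\<close> with
    \<open>a \<le> 5\<close>; times 128 it gives 6225920.\<close>
  have finish: ?thesis if "R\<^sup>2 \<le> 48640 * N * d\<^sup>2"
  proof -
    have "128 * G * R\<^sup>2 * real k \<le> 128 * G * (48640 * N * d\<^sup>2) * real k"
      using that G by (intro mult_right_mono mult_left_mono) auto
    then show ?thesis using small by (simp add: G_def mult_ac)
  qed
  have N_mono: "48640 * d\<^sup>2 \<le> 48640 * N * d\<^sup>2"
    using N1 by (intro mult_right_mono) auto
  \<comment> \<open>The cut at 5 makes \<open>2 / a\<close> less than \<open>2 / 5\<close> in the
    last case, the exponent in the hypothesis on \<open>N\<close>.\<close>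
  consider "a \<le> 5" | "a * (real n powr \<kappa>)\<^sup>2 \<le> real r" | "a > 5" "real r < a * (real n powr \<kappa>)\<^sup>2"
    by linarith
  then show ?thesis
  proof cases
    case 1
    then have "a * d\<^sup>2 \<le> 5 * d\<^sup>2" by (intro mult_right_mono) auto
    then show ?thesis using R2a N_mono by (intro finish) linarith
  next
    case 2
    then show ?thesis using R2 rD N_mono zero_le_power2[of d] by (intro finish) linarith
  next
    case 3
    have aln: "a \<le> ln (real n)" using a(3) 3(1) by (auto simp: max_def split: if_splits)
    show ?thesis
    proof (cases "real n \<ge> N")
      case False
      \<comment> \<open>Below \<open>N\<close> the exponent satisfies
        \<open>a \<le> ln n \<le> n < N\<close>, so it is bounded; this is why \<open>N\<close>
        enters the constant.\<close>
      have "ln (real n) \<le> real n" using r ln_le_minus_one[of "real n"] by simp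
      then have "a \<le> N" using aln False by linarith
      then have "a * d\<^sup>2 \<le> N * d\<^sup>2" by (intro mult_right_mono) auto
      moreover have "0 \<le> N * d\<^sup>2" using N1 by simp
      ultimately show ?thesis using R2a by (intro finish) linarith
    next
      case True
      let ?l = "ln (real n)"
      have l: "?l > 0" using aln a(1) by linarith
      have "(real n powr \<kappa>)\<^sup>2 \<le> (real n powr (1 / a))\<^sup>2"
        using a(2) r by (intro power_mono powr_mono) auto
      then have "a * (real n powr \<kappa>)\<^sup>2 \<le> a * (real n powr (1 / a))\<^sup>2"
        using a(1) by (intro mult_left_mono) auto
      then have "R\<^sup>2 \<le> 1536 * (a * (real n powr (1 / a))\<^sup>2)"
        using norm_bound_square_le[OF a(1), of n r] 3(2) by (simp add: R_def)
      also have "\<dots> \<le> 1536 * (?l * real n powr (2 / 5))"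
      proof (intro mult_left_mono mult_mono)
        have "(real n powr (1 / a))\<^sup>2 = real n powr (2 / a)"
          using r by (simp add: powr_power)
        also have "\<dots> \<le> real n powr (2 / 5)"
          using 3(1) r by (intro powr_mono) (auto simp: field_simps)
        finally show "(real n powr (1 / a))\<^sup>2 \<le> real n powr (2 / 5)" .
      qed (use aln l in auto)
      finally have "R\<^sup>2 \<le> 1536 * ?l * real n powr (2 / 5)" by simp
      then have "exp (?l / 16) * sqrt (real n * (G * R\<^sup>2 * (?l / 16))) \<le>
          exp (?l / 16) * sqrt (real n * (G * (1536 * ?l * real n powr (2 / 5)) * (?l / 16)))"
        using G l by (intro mult_left_mono real_sqrt_le_mono mult_right_mono) auto
      also have "\<dots> \<le> real n / 16" using N[OF True] by (simp add: G_def)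
      finally have "real n * real r * (?l / 16) \<le> 4 * G * R\<^sup>2 * real k"
        using l by (intro bound) auto
      also have "\<dots> \<le> 4 * G * (9728 * ?l * d\<^sup>2) * real k"
      proof -
        have "a * d\<^sup>2 \<le> ?l * d\<^sup>2" using aln by (intro mult_right_mono) auto
        then have "R\<^sup>2 \<le> 9728 * ?l * d\<^sup>2" using R2a by linarith
        then show ?thesis using G by (intro mult_right_mono mult_left_mono) auto
      qed
      finally have "?l * (real n * real r) \<le> ?l * (622592 * (G * d\<^sup>2 * real k))" by (simp add: mult_ac)
      then have "real n * real r \<le> 622592 * (G * d\<^sup>2 * real k)" using l by simp
      also have "\<dots> \<le> 6225920 * N * (G * d\<^sup>2 * real k)"
        using N1 G by (intro mult_right_mono) auto
      finally show ?thesis by (simp add: G_def mult_ac)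
    qed
  qed
qed

theorem theorem4p11:
  fixes \<gamma> :: real
  assumes "\<gamma> > 1"
  shows "\<exists>C>0. \<forall>(p::real) (q::real) (q'::ennreal) (n::nat) (r::nat) (k::nat) S f.
           p \<in> {1..2} \<longrightarrow> q \<in> {1..2} \<longrightarrow> 1 / ennreal q + 1 / q' = 1 \<longrightarrow>
           1 \<le> r \<longrightarrow> r \<le> n \<longrightarrow>
           sketching_family k \<gamma> q p n (rank_matrices n r) S f \<longrightarrow>
           (let d = max (sqrt (real r)) (real n powr enn2real (1 / q'))
            in real k \<ge> C * (real n * real r / d\<^sup>2))"
proof -
  have G: "(\<gamma>\<^sup>2 + 1)\<^sup>2 > 0" by (intro zero_less_power add_nonneg_pos) auto
  obtain N where N: "N \<ge> 1" "\<And>n::nat. real n \<ge> N \<Longrightarrow> exp (ln (real n) / 16) *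
      sqrt (real n * ((\<gamma>\<^sup>2 + 1)\<^sup>2 * (1536 * ln (real n) * real n powr (2 / 5)) * (ln (real n) / 16))) \<le> real n / 16"
    using large_dimension_regime[OF G] by blast
  define K where "K = 6225920 * (\<gamma>\<^sup>2 + 1)\<^sup>2 * N"
  have K: "K > 0" using G N(1) by (simp add: K_def)
  have "1 / K * (real n * real r / d\<^sup>2) \<le> real k"
    if "p \<in> {1..2}" "q \<in> {1..2}" "1 / ennreal q + 1 / q' = 1" "1 \<le> r" "r \<le> n"
      "sketching_family k \<gamma> q p n (rank_matrices n r) S f"
      "d = max (sqrt (real r)) (real n powr enn2real (1 / q'))"
    for p q q' n r k S f d
  proof -
    have "d > 0" using that(4,7) by (simp add: less_max_iff_disj)
    have "real n * real r \<le> K * d\<^sup>2 * real k"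
      using sketching_lower_bound[OF assms N that(1,2) conjugate_exponent[OF that(2,3)] that(4-7)]
      by (simp add: K_def)
    then show ?thesis using K \<open>d > 0\<close> by (simp add: field_simps)
  qed
  then show ?thesis
    using K by (intro exI[of _ "1 / K"] conjI allI impI) (simp_all add: Let_def)
qed

end
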